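(* Assume that $\mathcal{Z}$ is an integrally Hilbertian ring that is a near UFD or a Dedekind domain (e.g. the ring of integers of a number field). Let $P_1(T),\dots,P_s(T)\in \mathcal{Z}[T]$ be $s$ polynomials, irreducible in $\mathcal{Q}[T]$, and such that $P_1\cdots P_s$ has no fixed divisor w.r.t. $T$ in ${\rm Nonunit}\, \mathcal{Z}$. Let $(d_1,\dots,d_n) \in \mathbb{N}^n$ be a nonzero tuple. Then it is possible to substitute some polynomial $M(\underline{Y})$ with $\deg_{Y_j}(M)=d_j$ ($j=1,\dots,n$) for the parameter $T$ in the original polynomials $P_1,\dots,P_s$ in such a way that the resulting polynomials $P_i(M(\underline{Y}))$ ($i=1,\dots,s$) are irreducible in $\mathcal{Z}[\underline{Y}]$, and that the product $P_1(M(\underline{Y}))\cdots P_s(M(\underline{Y}))$ has no fixed divisor w.r.t. $\underline{Y}$ in ${\rm Nonunit}\, \mathcal{Z}$.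
   Context: $\mathcal{Z}$ is an integral domain with fraction field $\mathcal{Q}$, $\underline Y=(Y_1,\dots,Y_n)$. ${\rm Nonunit}\,\mathcal{Z}$ is the set of nonzero principal proper ideals. A proper ideal $\mathfrak{p}$ is a fixed divisor of $P\in\mathcal{Z}[\underline T,\underline Y]$ w.r.t. $\underline T$ if $P(\underline t,\underline Y)\equiv0\pmod{\mathfrak{p}}$ for all $\underline t\in\mathcal{Z}^k$. Near UFD: every nonzero element has finitely many prime divisors (modulo units) and every nonunit has at least one prime divisor. Integrally Hilbertian (w.r.t. ${\rm Nonunit}$): for any $k,n,s\geq1$ and $P_1,\dots,P_s\in\mathcal{Z}[\underline T,\underline Y]$ irreducible in $\mathcal{Q}(\underline T)[\underline Y]$, primitive w.r.t. $\mathcal{Q}[\underline T]$, with $P_1\cdots P_s$ having no fixed divisor in ${\rm Nonunit}\,\mathcal{Z}$ w.r.t. $\underline T$, the set of $\underline m\in\mathcal{Z}^k$ such that each $P_i(\underline m,\underline Y)$ is irreducible in $\mathcal{Q}[\underline Y]$ and $\prod_iP_i(\underline m,\underline Y)$ has no nonunit divisor in $\mathcal{Z}$ is Zariski-dense. *)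

theory Defs
  imports
    "HOL-Algebra.Algebraic_Closure_Type"
    "HOL-Algebra.Ring_Divisibility"
    "HOL-Computational_Algebra.Computational_Algebra"
    "HOL-Library.Poly_Mapping"
begin

section \<open>Ideals of the ring of all elements of a type\<close>

abbreviation type_ring :: "'a::ring_1 ring"
  where "type_ring \<equiv> ring_of_type_algebra"

definition Nonunit :: "'a::idom set set"
  where "Nonunit = {I. principalideal I type_ring \<and> I \<noteq> {0} \<and> I \<noteq> UNIV}"

section \<open>Polynomials in finitely many variables\<close>

text \<open>
  A polynomial in the variables with indices \<open>0, 1, 2, \<dots>\<close> maps monomials (finitely supported
  exponent functions) to coefficients; multiplication is the convolution product. Restricting
  the carrier to the variables with index below \<open>n\<close> and to coefficients in a subring \<open>S\<close> gives
  the ring \<open>S[Y\<^sub>0, \<dots>, Y\<^sub>n\<^sub>-\<^sub>1]\<close>, in which units and irreducibility are taken.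
  Nesting the type gives \<open>\<Z>[T, Y]\<close> as \<open>\<Z>[T][Y]\<close>.
\<close>

type_synonym 'a mpoly = "(nat \<Rightarrow>\<^sub>0 nat) \<Rightarrow>\<^sub>0 'a"

definition mpoly_ring :: "nat \<Rightarrow> 'a::comm_ring_1 set \<Rightarrow> 'a mpoly ring"
  where "mpoly_ring n S = type_ring\<lparr>carrier :=
    {p. (\<forall>m \<in> Poly_Mapping.keys p. Poly_Mapping.keys m \<subseteq> {..<n})
      \<and> (\<forall>m. Poly_Mapping.lookup p m \<in> S)}\<rparr>"

definition mpoly_const :: "'a::zero \<Rightarrow> 'a mpoly"
  where "mpoly_const c = Poly_Mapping.single 0 c"

text \<open>
  A point of affine \<open>k\<close>-space is given by a function on all indices, of which a polynomial in
  \<open>k\<close> variables only sees the values at \<open>0, \<dots>, k - 1\<close>.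
\<close>

definition mpoly_eval :: "(nat \<Rightarrow> 'a) \<Rightarrow> 'a mpoly \<Rightarrow> 'a::comm_semiring_1"
  where "mpoly_eval t p = (\<Sum>m \<in> Poly_Mapping.keys p.
    Poly_Mapping.lookup p m * (\<Prod>i \<in> Poly_Mapping.keys m. t i ^ Poly_Mapping.lookup m i))"

definition var_degree :: "nat \<Rightarrow> 'a::zero mpoly \<Rightarrow> nat"
  where "var_degree j p = Max (insert 0 ((\<lambda>m. Poly_Mapping.lookup m j) ` Poly_Mapping.keys p))"

definition specialize :: "(nat \<Rightarrow> 'a) \<Rightarrow> 'a mpoly mpoly \<Rightarrow> 'a::comm_semiring_1 mpoly"
  where "specialize t P = Poly_Mapping.map (mpoly_eval t) P"

definition fract_mpoly :: "'a::idom mpoly \<Rightarrow> 'a fract mpoly"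
  where "fract_mpoly p = Poly_Mapping.map to_fract p"

text \<open>The image of \<open>P \<in> \<Z>[T][Y]\<close> in \<open>\<Q>[T][Y]\<close> and in \<open>\<Q>(T)[Y]\<close>, where \<open>\<Q> = Frac(\<Z>)\<close>.\<close>

definition to_QT_Y :: "'a::idom mpoly mpoly \<Rightarrow> 'a fract mpoly mpoly"
  where "to_QT_Y P = Poly_Mapping.map fract_mpoly P"

definition to_rat_QT_Y :: "'a::idom mpoly mpoly \<Rightarrow> 'a fract mpoly fract mpoly"
  where "to_rat_QT_Y P = Poly_Mapping.map to_fract (to_QT_Y P)"

text \<open>
  \<open>K(T\<^sub>0, \<dots>, T\<^sub>k\<^sub>-\<^sub>1)\<close>, inside the field of rational functions in all variables.
\<close>

definition rat_funs :: "nat \<Rightarrow> 'a::field mpoly fract set"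
  where "rat_funs k = {Fract a b | a b.
    a \<in> carrier (mpoly_ring k UNIV) \<and> b \<in> carrier (mpoly_ring k UNIV) \<and> b \<noteq> 0}"

definition primitive_wrt_QT :: "nat \<Rightarrow> 'a::idom mpoly mpoly \<Rightarrow> bool"
  where "primitive_wrt_QT k P \<longleftrightarrow>
    (\<forall>c \<in> carrier (mpoly_ring k UNIV).
      (\<forall>m. c divides\<^bsub>mpoly_ring k UNIV\<^esub> Poly_Mapping.lookup (to_QT_Y P) m)
        \<longrightarrow> c \<in> Units (mpoly_ring k UNIV))"

section \<open>Fixed divisors\<close>

definition vanishes_mod :: "'a::idom set \<Rightarrow> 'a mpoly \<Rightarrow> bool"
  where "vanishes_mod I p \<longleftrightarrow> (\<forall>m. Poly_Mapping.lookup p m \<in> I)"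

text \<open>
  Fixed divisors with respect to \<open>T\<close> of an element of \<open>\<Z>[T][Y]\<close>, and the same notion for a
  polynomial in several parameters, or one parameter, and without further variables.
\<close>

definition fixed_divisor :: "'a::idom set \<Rightarrow> 'a mpoly mpoly \<Rightarrow> bool"
  where "fixed_divisor I P \<longleftrightarrow>
    ideal I type_ring \<and> I \<noteq> UNIV \<and> (\<forall>t. vanishes_mod I (specialize t P))"

definition fixed_divisor_mpoly :: "'a::idom set \<Rightarrow> 'a mpoly \<Rightarrow> bool"
  where "fixed_divisor_mpoly I p \<longleftrightarrow>
    ideal I type_ring \<and> I \<noteq> UNIV \<and> (\<forall>t. mpoly_eval t p \<in> I)"

definition fixed_divisor_poly :: "'a::idom set \<Rightarrow> 'a poly \<Rightarrow> bool"
  where "fixed_divisor_poly I p \<longleftrightarrow>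
    ideal I type_ring \<and> I \<noteq> UNIV \<and> (\<forall>t. poly p t \<in> I)"

section \<open>Classes of integral domains\<close>

text \<open>
  ``Nonunit'' means nonzero nonunit. The zero element has a prime divisor as soon as any prime
  element exists, so this only affects fields, which are thereby admitted.
\<close>

definition near_ufd :: "'a::idom itself \<Rightarrow> bool"
  where "near_ufd _ \<longleftrightarrow>
    (\<forall>a::'a. a \<noteq> 0 \<longrightarrow>
      finite ({p. prime_elem p \<and> p dvd a} // {(p, q). \<exists>u. u dvd 1 \<and> q = u * p})) \<and>
    (\<forall>a::'a. a \<noteq> 0 \<and> \<not> a dvd 1 \<longrightarrow> (\<exists>p. prime_elem p \<and> p dvd a))"

definition integrally_closed :: "'a::idom itself \<Rightarrow> bool"
  where "integrally_closed _ \<longleftrightarrow>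
    (\<forall>x::'a fract. (\<exists>f::'a poly. lead_coeff f = 1 \<and> poly (fract_poly f) x = 0)
      \<longrightarrow> x \<in> range to_fract)"

definition dedekind_domain :: "'a::idom itself \<Rightarrow> bool"
  where "dedekind_domain Z \<longleftrightarrow>
    noetherian_ring (type_ring :: 'a ring) \<and> integrally_closed Z \<and>
    (\<forall>I::'a set. primeideal I type_ring \<and> I \<noteq> {0} \<longrightarrow> maximalideal I type_ring)"

text \<open>
  Density in affine \<open>k\<close>-space over \<open>\<Q>\<close>: no nonzero polynomial over \<open>\<Q>\<close> vanishes on the set.
\<close>

definition zariski_dense :: "nat \<Rightarrow> (nat \<Rightarrow> 'a::idom) set \<Rightarrow> bool"
  where "zariski_dense k H \<longleftrightarrow>
    (\<forall>F :: 'a fract mpoly. F \<in> carrier (mpoly_ring k UNIV) \<and>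
      (\<forall>m \<in> H. mpoly_eval (\<lambda>i. to_fract (m i)) F = 0) \<longrightarrow> F = 0)"

definition integrally_hilbertian :: "'a::idom itself \<Rightarrow> bool"
  where "integrally_hilbertian _ \<longleftrightarrow>
    (\<forall>k n s. \<forall>P :: nat \<Rightarrow> 'a mpoly mpoly.
      k \<ge> 1 \<and> n \<ge> 1 \<and> s \<ge> 1 \<and>
      (\<forall>i<s. P i \<in> carrier (mpoly_ring n (carrier (mpoly_ring k UNIV))) \<and>
        ring_irreducible\<^bsub>mpoly_ring n (rat_funs k)\<^esub> (to_rat_QT_Y (P i)) \<and>
        primitive_wrt_QT k (P i)) \<and>
      \<not> (\<exists>I \<in> Nonunit. fixed_divisor I (\<Prod>i<s. P i))
      \<longrightarrow> zariski_dense k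
        {m. (\<forall>i<s. ring_irreducible\<^bsub>mpoly_ring n UNIV\<^esub> (fract_mpoly (specialize m (P i)))) \<and>
            \<not> (\<exists>I \<in> Nonunit. vanishes_mod I (\<Prod>i<s. specialize m (P i)))})"

text \<open>\<open>P(M(Y))\<close> for \<open>P \<in> \<Z>[T]\<close> and \<open>M \<in> \<Z>[Y]\<close>.\<close>

definition subst_mpoly :: "'a::comm_ring_1 poly \<Rightarrow> 'a mpoly \<Rightarrow> 'a mpoly"
  where "subst_mpoly P M = poly (map_poly mpoly_const P) M"

end

theory Submission
  imports Defs
begin

text \<open>
  One parameter suffices: put \<open>Q\<^sub>i(T, Y) = P\<^sub>i(t + w(T + Y\<^sup>d))\<close> with \<open>Y\<^sup>d\<close> a monomial of multidegree
  \<open>d\<close>. The automorphism \<open>T \<mapsto> T - Y\<^sup>d\<close> of \<open>\<Q>[T, Y]\<close> carries \<open>Q\<^sub>i\<close> to \<open>P\<^sub>i(t + wT)\<close>, a prime element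
  of \<open>\<Q>[T]\<close>, hence of \<open>\<Q>[T, Y]\<close> by Gauss' lemma; clearing denominators makes \<open>Q\<^sub>i\<close> irreducible in
  \<open>\<Q>(T)[Y]\<close>. The integral Hilbert property yields \<open>m\<close>, and \<open>M = t + w(m + Y\<^sup>d)\<close> is the required
  substitution as soon as a coefficient condition modulo nonunits can be turned into a condition on
  values. Modulo a primary ideal whose prime has more residues than the degree this is automatic.
  Only finitely many primes remain; \<open>t\<close> and \<open>w\<close> are chosen by the Chinese remainder theorem such that
  at each of them \<open>P\<^sub>1 \<cdots> P\<^sub>s\<close> takes on \<open>t + w\<Z>\<close> only values of the least possible order. In a
  near UFD it suffices to avoid the principal primes themselves; in a Dedekind domain the order is
  measured by a local uniformizer.
\<close>


section \<open>Ideals of a commutative ring type\<close>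

text \<open>The obstacle is that the Hilbert property controls common divisors of coefficients,
  while fixed divisors concern values: modulo 2 the polynomial X^2 - X has coprime coefficients but
  only zero values. This gap is crossed twice, once to see that P(t + wT) has no fixed divisor
  w.r.t. T, so that the Hilbert property applies, and once for the final polynomial in Y. In a
  Dedekind domain P may still take all its values in a nonprincipal \<open>q\<close>. Then
  \<open>w\<close> in \<open>q\<close> is demanded, so that all coefficients of P(t + wX) lie in
  \<open>q\<close> as well and the coefficient condition never singles out this \<open>q\<close>. In
  the second crossing all variables except one are set to 1: the monomial becomes y^e with e = d_j >
  0, which explains the bound deg(P) * e on the degree.\<close>

lemma type_ring_simps [simp]:
  "carrier (type_ring :: 'a::ring_1 ring) = UNIV"
  "x \<otimes>\<^bsub>type_ring\<^esub> y = x * y" "x \<oplus>\<^bsub>type_ring\<^esub> y = x + y"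
  "\<one>\<^bsub>type_ring\<^esub> = 1" "\<zero>\<^bsub>type_ring\<^esub> = 0"
  by (simp_all add: ring_of_type_algebra_def)

lemma ideal_type_ring_iff:
  "ideal I (type_ring :: 'a::comm_ring_1 ring) \<longleftrightarrow>
    0 \<in> I \<and> (\<forall>x\<in>I. \<forall>y\<in>I. x + y \<in> I) \<and> (\<forall>x\<in>I. \<forall>r. r * x \<in> I)"
proof
  assume "ideal I (type_ring :: 'a ring)"
  then interpret ideal I "type_ring :: 'a ring" .
  show "0 \<in> I \<and> (\<forall>x\<in>I. \<forall>y\<in>I. x + y \<in> I) \<and> (\<forall>x\<in>I. \<forall>r. r * x \<in> I)"
    using additive_subgroup.zero_closed[OF additive_subgroup_axioms]
      additive_subgroup.a_closed[OF additive_subgroup_axioms] I_l_closed by simp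
next
  assume *: "0 \<in> I \<and> (\<forall>x\<in>I. \<forall>y\<in>I. x + y \<in> I) \<and> (\<forall>x\<in>I. \<forall>r. r * x \<in> I)"
  interpret R: ring "type_ring :: 'a ring" by (rule ring_from_type_algebra)
  have minus: "inv\<^bsub>add_monoid type_ring\<^esub> x = - x" for x :: 'a
    unfolding a_inv_def[symmetric] by (rule R.minus_equality) auto
  have "- x \<in> I" if "x \<in> I" for x
    using * that by (metis mult_minus1)
  then show "ideal I (type_ring :: 'a ring)"
    using * by (intro idealI R.ring_axioms subgroup.intro)
      (auto simp: mult.commute minus[simplified])
qed

lemma ideal_diff:
  assumes "ideal I (type_ring :: 'a::comm_ring_1 ring)" "x \<in> I" "y \<in> I"
  shows "x - y \<in> I"
  using assms unfolding ideal_type_ring_iff by (metis diff_conv_add_uminus mult_minus1)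

lemma ideal_sum:
  assumes "ideal I (type_ring :: 'a::comm_ring_1 ring)" "\<And>x. x \<in> A \<Longrightarrow> f x \<in> I"
  shows "sum f A \<in> I"
  using assms(2) by (induction A rule: infinite_finite_induct)
    (use assms(1) in \<open>auto simp: ideal_type_ring_iff\<close>)

lemma ideal_mult_right:
  assumes "ideal I (type_ring :: 'a::comm_ring_1 ring)" "x \<in> I"
  shows "x * r \<in> I"
  using assms unfolding ideal_type_ring_iff by (metis mult.commute)

lemma
  assumes "ideal I (type_ring :: 'a::comm_ring_1 ring)"
  shows ideal_zero: "0 \<in> I"
    and ideal_add: "x \<in> I \<Longrightarrow> y \<in> I \<Longrightarrow> x + y \<in> I"
    and ideal_mult_left: "x \<in> I \<Longrightarrow> r * x \<in> I"
    and ideal_uminus: "x \<in> I \<Longrightarrow> - x \<in> I"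
  using assms unfolding ideal_type_ring_iff by (blast, blast, blast, metis mult_minus1)

lemma ideal_dvd:
  assumes "ideal I (type_ring :: 'a::comm_ring_1 ring)" "x \<in> I" "x dvd y"
  shows "y \<in> I"
  using assms ideal_mult_right by (metis dvdE)

lemma ideal_UNIV_iff:
  assumes "ideal I (type_ring :: 'a::comm_ring_1 ring)"
  shows "I = UNIV \<longleftrightarrow> 1 \<in> I"
  using ideal_mult_right[OF assms, of 1] by auto

lemma primeideal_type_ring_iff:
  "primeideal p (type_ring :: 'a::comm_ring_1 ring) \<longleftrightarrow>
    ideal p type_ring \<and> 1 \<notin> p \<and> (\<forall>x y. x * y \<in> p \<longrightarrow> x \<in> p \<or> y \<in> p)"
  using cring_from_type_algebra[where 'a = 'a] ideal_UNIV_iff[of p]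
  by (auto simp: primeideal_def primeideal_axioms_def)

lemma ideal_multiples: "ideal {x. c dvd x} (type_ring :: 'a::comm_ring_1 ring)"
  by (auto simp: ideal_type_ring_iff)

lemma genideal_singleton: "Idl\<^bsub>type_ring\<^esub> {c :: 'a::comm_ring_1} = {x. c dvd x}"
  unfolding genideal_def using ideal_multiples[of c] ideal_dvd by force

lemma Nonunit_iff:
  "I \<in> Nonunit \<longleftrightarrow> (\<exists>c :: 'a::idom. c \<noteq> 0 \<and> \<not> c dvd 1 \<and> I = {x. c dvd x})"
proof -
  have principal: "principalideal I type_ring \<longleftrightarrow> (\<exists>c::'a. I = {x. c dvd x})"
    using ideal_multiples
    by (auto simp: principalideal_def principalideal_axioms_def genideal_singleton)
  have zero: "{x. c dvd x} = {0} \<longleftrightarrow> c = 0" for c :: 'a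
    using dvd_refl[of c] dvd_0_left_iff[where 'a = 'a] by blast
  have unit: "{x. c dvd x} = UNIV \<longleftrightarrow> c dvd 1" for c :: 'a
    using ideal_UNIV_iff[OF ideal_multiples[of c]] by simp
  show ?thesis
    unfolding Nonunit_def mem_Collect_eq principal
    by (intro iffI; elim exE conjE) (metis zero unit)+
qed

lemma primeideal_power:
  assumes "primeideal p (type_ring :: 'a::comm_ring_1 ring)" "x \<notin> p"
  shows "x ^ k \<notin> p"
  using assms by (induction k) (auto simp: primeideal_type_ring_iff)

lemma primeideal_prod:
  assumes "primeideal p (type_ring :: 'a::comm_ring_1 ring)" "\<And>x. x \<in> A \<Longrightarrow> f x \<notin> p"
  shows "prod f A \<notin> p"
  using assms(2) by (induction A rule: infinite_finite_induct)
    (use assms(1) in \<open>auto simp: primeideal_type_ring_iff\<close>)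

lemma prime_elem_primeideal:
  assumes "prime_elem (c :: 'a::comm_ring_1)"
  shows "primeideal {x. c dvd x} type_ring"
  using assms ideal_multiples[of c]
  by (auto simp: primeideal_type_ring_iff prime_elem_dvd_mult_iff prime_elem_not_unit)

text \<open>Zorn's lemma applies because in a Noetherian ring the union of a nonempty chain of
  ideals is itself a member of the chain.\<close>

lemma noetherian_maximal_element:
  assumes "noetherian_ring (type_ring :: 'a::comm_ring_1 ring)"
    and "C \<noteq> {}" "\<And>I. I \<in> C \<Longrightarrow> ideal I (type_ring :: 'a ring)"
  shows "\<exists>M\<in>C. \<forall>I\<in>C. M \<subseteq> I \<longrightarrow> I = M"
proof -
  have "\<Union>D \<in> C" if "D \<noteq> {}" "subset.chain C D" for D
  proof -
    have "subset.chain {I. ideal I (type_ring :: 'a ring)} D"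
      using that(2) assms(3) by (auto simp: subset_chain_def)
    from noetherian_ring.ideal_chain_is_trivial[OF assms(1) that(1) this]
    show ?thesis using that(2) by (auto simp: subset_chain_def)
  qed
  with subset_Zorn_nonempty[OF assms(2)] show ?thesis by blast
qed

section \<open>Ring homomorphisms and polynomials\<close>

definition type_hom :: "('a::comm_ring_1 \<Rightarrow> 'b::comm_ring_1) \<Rightarrow> bool"
  where "type_hom h \<longleftrightarrow>
    h 1 = 1 \<and> (\<forall>x y. h (x + y) = h x + h y) \<and> (\<forall>x y. h (x * y) = h x * h y)"

lemma
  assumes "type_hom h"
  shows type_hom_one: "h 1 = 1"
    and type_hom_add: "h (x + y) = h x + h y"
    and type_hom_mult: "h (x * y) = h x * h y"
    and type_hom_zero: "h 0 = 0"
    and type_hom_uminus: "h (- x) = - h x"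
proof -
  show "h 1 = 1" "h (x + y) = h x + h y" "h (x * y) = h x * h y"
    using assms by (auto simp: type_hom_def)
  have "h (0 + 0) = h 0 + h 0" "h (x + - x) = h x + h (- x)"
    using assms unfolding type_hom_def by blast+
  then show "h 0 = 0" "h (- x) = - h x"
    by (simp_all add: eq_neg_iff_add_eq_0 add.commute)
qed

lemma type_hom_sum: "type_hom h \<Longrightarrow> h (sum f A) = (\<Sum>x\<in>A. h (f x))"
  by (induction A rule: infinite_finite_induct) (auto simp: type_hom_zero type_hom_add)

lemma type_hom_prod: "type_hom h \<Longrightarrow> h (prod f A) = (\<Prod>x\<in>A. h (f x))"
  by (induction A rule: infinite_finite_induct) (auto simp: type_hom_one type_hom_mult)

lemma type_hom_power: "type_hom h \<Longrightarrow> h (x ^ k) = h x ^ k"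
  by (induction k) (auto simp: type_hom_one type_hom_mult)

lemma type_hom_comp: "type_hom g \<Longrightarrow> type_hom h \<Longrightarrow> type_hom (\<lambda>x. g (h x))"
  by (auto simp: type_hom_def)

lemma type_hom_id: "type_hom (\<lambda>x. x)"
  by (auto simp: type_hom_def)

lemma type_hom_poly: "type_hom h \<Longrightarrow> h (poly p x) = poly (map_poly h p) (h x)"
  by (induction p) (auto simp: type_hom_zero type_hom_add type_hom_mult map_poly_pCons)

lemma type_hom_map_poly:
  assumes "type_hom h"
  shows "type_hom (map_poly h)"
  unfolding type_hom_def
  by (simp add: poly_eq_iff coeff_map_poly coeff_mult type_hom_zero[OF assms] type_hom_add[OF assms]
      type_hom_mult[OF assms] type_hom_sum[OF assms] type_hom_one[OF assms])

lemma map_poly_pcompose: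
  assumes "type_hom h"
  shows "map_poly h (pcompose p q) = pcompose (map_poly h p) (map_poly h q)"
  by (induction p)
    (auto simp: pcompose_pCons map_poly_pCons type_hom_zero[OF assms]
      type_hom_add[OF type_hom_map_poly[OF assms]] type_hom_mult[OF type_hom_map_poly[OF assms]])

lemma type_hom_eval_poly: "type_hom (\<lambda>p. poly p a)"
  by (auto simp: type_hom_def)

lemma type_hom_const_poly: "type_hom (\<lambda>c. [:c:])"
  by (auto simp: type_hom_def one_pCons)

lemma type_hom_to_fract: "type_hom to_fract"
  by (auto simp: type_hom_def)

section \<open>Values of polynomials modulo primary ideals\<close>

text \<open>Only the cancellation of elements outside \<open>p\<close> is recorded; this is what
  dividing by differences of residues uses. A prime ideal is primary to itself.\<close>

definition primary_to :: "'a::comm_ring_1 set \<Rightarrow> 'a set \<Rightarrow> bool"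
  where "primary_to p q \<longleftrightarrow> ideal q type_ring \<and> (\<forall>x y. x * y \<in> q \<longrightarrow> x \<notin> p \<longrightarrow> y \<in> q)"

definition separated_mod :: "'a::comm_ring_1 set \<Rightarrow> 'a set \<Rightarrow> bool"
  where "separated_mod p A \<longleftrightarrow> (\<forall>a\<in>A. \<forall>b\<in>A. a \<noteq> b \<longrightarrow> a - b \<notin> p)"

lemma primary_to_ideal: "primary_to p q \<Longrightarrow> ideal q type_ring"
  by (simp add: primary_to_def)

text \<open>Divide f by X - a for one of the points. At every other point b the quotient has value
  in \<open>q\<close>, because (b - a) times it is f(b) - f(a) and b - a is cancellable modulo
  \<open>q\<close>. Induction on the number of points then treats the quotient, and f = (X - a) g +
  f(a).\<close>

lemma coeff_mem_if_values_mem: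
  assumes "primary_to p q" "separated_mod p A" "finite A" "Polynomial.degree f < card A"
    and "\<And>a. a \<in> A \<Longrightarrow> poly f a \<in> q"
  shows "Polynomial.coeff f n \<in> q"
  using assms(3,2,4,5)
proof (induction A arbitrary: f n rule: finite_induct)
  case (insert a A)
  note q = primary_to_ideal[OF assms(1)]
  let ?g = "synthetic_div f a"
  have f: "f = [:- a, 1:] * ?g + [:poly f a:]"
    by (rule synthetic_div_correct'[symmetric])
  have g: "Polynomial.coeff ?g k \<in> q" for k
  \<comment> \<open>For constant f the quotient is 0, but the strict bound of the induction
    hypothesis fails if no point is left.\<close>
  proof (cases "Polynomial.degree f = 0")
    case True
    then have "?g = 0" by (simp add: synthetic_div_eq_0_iff)
    then show ?thesis using q by (simp add: ideal_type_ring_iff)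
  next
    case False
    show ?thesis
    proof (rule insert.IH)
      show "separated_mod p A" using insert.prems by (auto simp: separated_mod_def)
      show "Polynomial.degree ?g < card A"
        using insert.prems(2) insert.hyps False by (simp add: degree_synthetic_div)
      fix b assume b: "b \<in> A"
      then have "b - a \<notin> p" using insert.hyps(2) insert.prems(1) by (auto simp: separated_mod_def)
      moreover have "poly f b - poly f a = (b - a) * poly ?g b"
        by (subst (1) f) (simp add: algebra_simps)
      then have "(b - a) * poly ?g b \<in> q"
        using ideal_diff[OF q, of "poly f b" "poly f a"] insert.prems(3) b by auto
      ultimately show "poly ?g b \<in> q" using assms(1) by (auto simp: primary_to_def)
    qed
  qed
  have fa: "poly f a \<in> q" using insert.prems(3) by simp
  have "Polynomial.coeff f n = - a * Polynomial.coeff ?g n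
      + Polynomial.coeff (pCons 0 ?g) n + Polynomial.coeff [:poly f a:] n"
    by (subst f) simp
  moreover have "Polynomial.coeff (pCons 0 ?g) n \<in> q" "Polynomial.coeff [:poly f a:] n \<in> q"
    "- a * Polynomial.coeff ?g n \<in> q"
    using g fa by (auto simp: coeff_pCons ideal_zero[OF q] split: nat.split
        intro!: ideal_mult_left[OF q] ideal_uminus[OF q])
  ultimately show ?case using q unfolding ideal_type_ring_iff by metis
qed simp

lemma coeff_mult_mem:
  assumes "ideal q (type_ring :: 'a::comm_ring_1 ring)" "\<And>n. Polynomial.coeff f n \<in> q"
  shows "Polynomial.coeff (g * f) n \<in> q"
  using assms by (auto simp: coeff_mult ideal_type_ring_iff intro!: ideal_sum[OF assms(1)])

lemma coeff_pcompose_mem: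
  assumes "ideal q (type_ring :: 'a::comm_ring_1 ring)" "\<And>n. Polynomial.coeff f n \<in> q"
  shows "Polynomial.coeff (pcompose f g) n \<in> q"
  using assms(2)
proof (induction f arbitrary: n)
  case (pCons a f)
  have "a \<in> q" using pCons.prems[of 0] by simp
  then have "Polynomial.coeff [:a:] n \<in> q" for n
    using assms(1) by (auto simp: coeff_pCons ideal_type_ring_iff split: nat.split)
  moreover have "Polynomial.coeff f n \<in> q" for n using pCons.prems[of "Suc n"] by simp
  then have "Polynomial.coeff (g * pcompose f g) n \<in> q" for n
    using coeff_mult_mem[OF assms(1) pCons.IH] by blast
  ultimately show ?case
    using assms(1) by (simp add: pcompose_pCons ideal_type_ring_iff)
qed (use assms(1) in \<open>auto simp: ideal_type_ring_iff\<close>)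

lemma poly_mem:
  assumes "ideal q (type_ring :: 'a::comm_ring_1 ring)" "\<And>n. Polynomial.coeff f n \<in> q"
  shows "poly f a \<in> q"
  unfolding poly_altdef using assms ideal_mult_right by (blast intro: ideal_sum)

text \<open>Write P(t + wX) = a + (t + wX) R. Its coefficient of index k + 1 is t R_(k+1) + w R_k,
  so descending from the degree of R and cancelling \<open>w\<close> puts every R_k, and finally a,
  into \<open>q\<close>.\<close>

lemma coeff_mem_if_shift_coeff_mem:
  fixes P :: "'a::comm_ring_1 poly"
  assumes "primary_to p q" "w \<notin> p" "\<And>n. Polynomial.coeff (pcompose P [:t, w:]) n \<in> q"
  shows "Polynomial.coeff P n \<in> q"
  using assms(3)
proof (induction P arbitrary: n)
  case (pCons a P)
  note q = primary_to_ideal[OF assms(1)]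
  let ?R = "pcompose P [:t, w:]"
  have R: "pcompose (pCons a P) [:t, w:] = [:a:] + Polynomial.smult t ?R + pCons 0 (Polynomial.smult w ?R)"
    by (simp add: pcompose_pCons)
  have Suc: "t * Polynomial.coeff ?R (Suc k) + w * Polynomial.coeff ?R k \<in> q" for k
    using pCons.prems[of "Suc k"] unfolding R by simp
  have step: "Polynomial.coeff ?R k \<in> q" if "Polynomial.coeff ?R (Suc k) \<in> q" for k
  proof -
    have "t * Polynomial.coeff ?R (Suc k) \<in> q" using that q by (auto simp: ideal_type_ring_iff)
    from ideal_diff[OF q Suc[of k] this] have "w * Polynomial.coeff ?R k \<in> q" by simp
    then show ?thesis using assms(1,2) by (auto simp: primary_to_def)
  qed
  have Rq: "Polynomial.coeff ?R k \<in> q" for k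
  proof (cases "k \<le> Suc (Polynomial.degree ?R)")
    case True
    then show ?thesis
    proof (induction rule: inc_induct)
      case base
      show ?case using q by (simp add: coeff_eq_0 ideal_type_ring_iff)
    qed (use step in blast)
  qed (use q in \<open>simp add: coeff_eq_0 ideal_type_ring_iff\<close>)
  have "t * Polynomial.coeff ?R 0 \<in> q" using Rq by (rule ideal_mult_left[OF q])
  moreover have "a + t * Polynomial.coeff ?R 0 \<in> q" using pCons.prems[of 0] unfolding R by simp
  ultimately have "a \<in> q" using ideal_diff[OF q] by (metis add_diff_cancel_right')
  then show ?case using pCons.IH[OF Rq] by (auto simp: coeff_pCons split: nat.split)
qed (use primary_to_ideal[OF assms(1)] in \<open>auto simp: ideal_type_ring_iff\<close>)

lemma poly_diff_mem:
  assumes "ideal q (type_ring :: 'a::comm_ring_1 ring)" "x - y \<in> q"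
  shows "poly f x - poly f y \<in> q"
proof (induction f)
  case (pCons a f)
  have "poly (pCons a f) x - poly (pCons a f) y = (x - y) * poly f x + y * (poly f x - poly f y)"
    by (simp add: algebra_simps)
  then show ?case
    using pCons assms ideal_mult_right[OF assms] by (simp add: ideal_type_ring_iff)
qed (use assms in \<open>auto simp: ideal_type_ring_iff\<close>)

section \<open>Primes with small residue rings\<close>

text \<open>A finite domain is a field: two of the powers 1, x, ..., x^N agree modulo
  \<open>p\<close>, and cancelling the smaller one exhibits an inverse of x. In a near UFD this is
  the only source of maximality, which the Chinese remainder theorem relies on.\<close>

lemma maximal_if_few_residues:
  assumes "primeideal p (type_ring :: 'a::comm_ring_1 ring)"
    and "\<nexists>A. card A = Suc N \<and> separated_mod p A" "x \<notin> p"
  shows "\<exists>y. 1 - x * y \<in> p"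
proof -
  have id: "ideal p (type_ring :: 'a ring)" using assms(1) by (simp add: primeideal_type_ring_iff)
  have "\<exists>i j. i < j \<and> x ^ i - x ^ j \<in> p"
  proof (rule ccontr)
    assume *: "\<nexists>i j. i < j \<and> x ^ i - x ^ j \<in> p"
    have ne: "x ^ i - x ^ j \<notin> p" if "i \<noteq> j" for i j
    proof (cases "i < j")
      case False
      then have "x ^ j - x ^ i \<notin> p" using * that by (meson linorder_neqE_nat)
      moreover have "0 \<in> p" using id by (simp add: ideal_type_ring_iff)
      ultimately show ?thesis using ideal_diff[OF id, of 0 "x ^ i - x ^ j"] by auto
    qed (use * in blast)
    have "inj_on ((^) x) {..N}"
      by (rule inj_onI) (metis ne id diff_self ideal_type_ring_iff)
    then have "card ((^) x ` {..N}) = Suc N" by (simp add: card_image)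
    moreover have "separated_mod p ((^) x ` {..N})"
      using ne unfolding separated_mod_def by (metis imageE)
    ultimately show False using assms(2) by blast
  qed
  then obtain i j where ij: "i < j" "x ^ i - x ^ j \<in> p" by blast
  have "x ^ i - x ^ j = x ^ i * (1 - x * x ^ (j - Suc i))"
    using ij(1) by (simp add: algebra_simps flip: power_Suc power_add)
  then show ?thesis
    using ij(2) primeideal_power[OF assms(1,3)] assms(1) by (metis primeideal_type_ring_iff)
qed

lemma infinite_if_nonunit:
  fixes c :: "'a::idom"
  assumes "(c :: 'a::idom) \<noteq> 0" "\<not> c dvd 1"
  shows "infinite (UNIV :: 'a set)"
proof
  assume "finite (UNIV :: 'a set)"
  then have "\<not> inj (\<lambda>k. c ^ k)"
    using finite_imageD infinite_UNIV_nat finite_subset[OF subset_UNIV] by metis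
  then obtain i j where ij: "i < j" "c ^ i = c ^ j"
    unfolding inj_def by (metis linorder_neqE_nat)
  then have "c ^ (i + Suc (j - Suc i)) = c ^ i * 1" by simp
  then have "c ^ i * (c * c ^ (j - Suc i)) = c ^ i * 1"
    by (simp only: power_add power_Suc)
  then have "c * c ^ (j - Suc i) = 1" using assms(1) by simp
  then show False using assms(2) by (metis dvd_triv_left)
qed

text \<open>The element is the product of all differences of N chosen distinct elements. A prime
  that does not contain it keeps their residues distinct, so every prime with too few residues
  contains this one nonzero element.\<close>

lemma separating_element:
  assumes "infinite (UNIV :: 'a::idom set)"
  obtains w :: "'a::idom" where "w \<noteq> 0"
    "\<And>p. primeideal p type_ring \<Longrightarrow> w \<notin> p \<Longrightarrow> \<exists>A. card A = N \<and> separated_mod p A"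
proof -
  obtain A :: "'a set" where A: "finite A" "card A = N"
    using infinite_arbitrarily_large[OF assms] by blast
  let ?w = "\<Prod>a\<in>A. \<Prod>b\<in>A - {a}. a - b"
  show ?thesis
  proof
    show "?w \<noteq> 0" using A(1) by auto
    fix p :: "'a set" assume p: "primeideal p type_ring" "?w \<notin> p"
    then have id: "ideal p type_ring" by (simp add: primeideal_type_ring_iff)
    have "a - b \<notin> p" if "a \<in> A" "b \<in> A" "a \<noteq> b" for a b
    proof -
      have "a - b dvd (\<Prod>b\<in>A - {a}. a - b)"
        using A(1) that by (intro dvd_prodI) auto
      also have "\<dots> dvd ?w" using A(1) that by (intro dvd_prodI) auto
      finally show ?thesis using p(2) ideal_dvd[OF id] by blast
    qed
    then show "\<exists>A. card A = N \<and> separated_mod p A"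
      using A(2) by (auto simp: separated_mod_def)
  qed
qed

section \<open>The Chinese remainder theorem\<close>

lemma crt_ideals:
  assumes "finite S" "\<And>i. i \<in> S \<Longrightarrow> ideal (Q i) (type_ring :: 'a::comm_ring_1 ring)"
    and "\<And>i j. i \<in> S \<Longrightarrow> j \<in> S \<Longrightarrow> i \<noteq> j \<Longrightarrow> \<exists>y\<in>Q j. 1 - y \<in> Q i"
  shows "\<exists>x. \<forall>i\<in>S. x - t i \<in> Q i"
  using assms
proof (induction S rule: finite_induct)
  case (insert k S)
  then obtain x where x: "\<forall>i\<in>S. x - t i \<in> Q i" by auto
  have id: "ideal (Q k) type_ring" using insert.prems by simp
  have "\<exists>y. y \<in> Q i \<and> 1 - y \<in> Q k" if "i \<in> S" for i
    using insert.prems(2)[of k i] insert.hyps(2) that by blast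
  then obtain y where y: "\<And>i. i \<in> S \<Longrightarrow> y i \<in> Q i \<and> 1 - y i \<in> Q k" by metis
  have "1 - prod y S' \<in> Q k" if "S' \<subseteq> S" for S'
    using finite_subset[OF that insert.hyps(1)] that
  proof (induction S' rule: finite_induct)
    case (insert j S')
    have "1 - y j * prod y S' = (1 - y j) + y j * (1 - prod y S')" by (simp add: algebra_simps)
    moreover have "\<dots> \<in> Q k"
      using insert y by (intro ideal_add[OF id] ideal_mult_left[OF id]) auto
    ultimately show ?case by (simp only: prod.insert[OF insert.hyps])
  qed (use id in \<open>auto simp: ideal_type_ring_iff\<close>)
  then have e: "1 - prod y S \<in> Q k" by simp
  have e': "prod y S \<in> Q i" if "i \<in> S" for i
    by (rule ideal_dvd[of _ "y i"])
      (use that insert.hyps(1) y insert.prems(1)[of i] in \<open>auto intro: dvd_prodI\<close>)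
  \<comment> \<open>\<open>prod y S\<close> is 1 modulo \<open>Q k\<close> and 0 modulo every older
    \<open>Q i\<close>, so this correction acts at \<open>k\<close> alone.\<close>
  let ?x = "x + prod y S * (t k - x)"
  have "?x - t k = (1 - prod y S) * (x - t k)" by (simp add: algebra_simps)
  then have "?x - t k \<in> Q k" using ideal_mult_right[OF id e] by simp
  moreover have "?x - t i \<in> Q i" if "i \<in> S" for i
  proof -
    have "?x - t i = (x - t i) + prod y S * (t k - x)" by simp
    moreover have "ideal (Q i) type_ring" using insert.prems that by simp
    ultimately show ?thesis
      using x e'[OF that] that ideal_mult_right unfolding ideal_type_ring_iff by metis
  qed
  ultimately show ?case by blast
qed auto

lemma one_minus_dvd_one_minus_power: "1 - x dvd 1 - (x :: 'a::comm_ring_1) ^ k"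
proof (induction k)
  case (Suc k)
  have "1 - x ^ Suc k = (1 - x) + x * (1 - x ^ k)" by (simp add: algebra_simps)
  then show ?case using Suc by (metis dvd_add dvd_mult dvd_refl)
qed simp

text \<open>Maximality gives an element xy of \<open>p'\<close> that is 1 modulo \<open>p\<close>.
  Its power z lies in \<open>Q'\<close>, and 1 - z lies in \<open>p\<close>, so (1 - z)^k lies in
  \<open>Q\<close>; the complement 1 - (1 - z)^k is divisible by z and hence lies in
  \<open>Q'\<close>.\<close>

lemma comaximal_powers:
  assumes p: "primeideal p (type_ring :: 'a::comm_ring_1 ring)" "\<And>x. x \<notin> p \<Longrightarrow> \<exists>y. 1 - x * y \<in> p"
    and p': "primeideal p' (type_ring :: 'a ring)" "\<And>x. x \<notin> p' \<Longrightarrow> \<exists>y. 1 - x * y \<in> p'"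
    and "p \<noteq> p'"
    and Q: "ideal Q type_ring" "\<And>x. x \<in> p \<Longrightarrow> x ^ k \<in> Q"
    and Q': "ideal Q' type_ring" "\<And>x. x \<in> p' \<Longrightarrow> x ^ k' \<in> Q'"
  shows "\<exists>y\<in>Q'. 1 - y \<in> Q"
proof -
  have id: "ideal p type_ring" "1 \<notin> p" "ideal p' type_ring"
    using p(1) p'(1) by (auto simp: primeideal_type_ring_iff)
  have "\<not> p' \<subseteq> p"
  proof
    assume "p' \<subseteq> p"
    then obtain z where z: "z \<in> p" "z \<notin> p'" using \<open>p \<noteq> p'\<close> by blast
    from p'(2)[OF z(2)] obtain y where "1 - z * y \<in> p" using \<open>p' \<subseteq> p\<close> by blast
    moreover have "z * y \<in> p" using ideal_mult_right[OF id(1) z(1)] .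
    ultimately have "1 - z * y + z * y \<in> p" using id(1) unfolding ideal_type_ring_iff by blast
    then show False using id(2) by simp
  qed
  then obtain x where x: "x \<in> p'" "x \<notin> p" by blast
  from p(2)[OF x(2)] obtain y where y: "1 - x * y \<in> p" by blast
  define z where "z = (x * y) ^ k'"
  have "x * y \<in> p'" using ideal_mult_right[OF id(3) x(1)] .
  then have z: "z \<in> Q'" unfolding z_def by (rule Q'(2))
  have "1 - x * y dvd 1 - z"
    unfolding z_def by (rule one_minus_dvd_one_minus_power)
  then have "1 - z \<in> p" using ideal_dvd[OF id(1) y] by blast
  then have "(1 - z) ^ k \<in> Q" by (rule Q(2))
  moreover have "1 - (1 - z) dvd 1 - (1 - z) ^ k"
    by (rule one_minus_dvd_one_minus_power)
  then have "1 - (1 - z) ^ k \<in> Q'" using ideal_dvd[OF Q'(1) z] by simp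
  ultimately show ?thesis by (intro bexI[of _ "1 - (1 - z) ^ k"]) auto
qed

section \<open>Adjusting a residue class at finitely many primes\<close>

text \<open>
  In a near UFD the pairs \<open>(p, p)\<close> with \<open>p\<close> a principal prime suffice; in a Dedekind domain all
  primary ideals \<open>q\<close> are needed, since the primes above a nonunit need not be principal.
\<close>

definition detects_nonunits :: "('a::idom set \<times> 'a set) set \<Rightarrow> bool"
  where "detects_nonunits Fam \<longleftrightarrow>
    (\<forall>(p, q) \<in> Fam. primary_to p q) \<and>
    (\<forall>A c. \<not> (\<exists>I\<in>Nonunit. A \<subseteq> I) \<longrightarrow> c \<noteq> 0 \<longrightarrow> \<not> c dvd 1 \<longrightarrow>
      (\<exists>(p, q) \<in> Fam. c \<in> q \<and> \<not> A \<subseteq> q))"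

text \<open>
  The first alternative covers primes where polynomials of degree below \<open>N\<close> can be recovered from
  their values, the second one the finitely many exceptional primes. If \<open>w \<in> q\<close> then \<open>P(t + wX)\<close>
  is congruent to the constant \<open>P(t)\<close> modulo \<open>q\<close>.
\<close>

definition adjusted_at :: "nat \<Rightarrow> 'a::idom poly \<Rightarrow> 'a \<Rightarrow> 'a \<Rightarrow> 'a set \<Rightarrow> 'a set \<Rightarrow> bool"
  where "adjusted_at N P t w p q \<longleftrightarrow>
    w \<notin> p \<and> (\<exists>A. card A = N \<and> separated_mod p A) \<or>
    (\<not> range (poly P) \<subseteq> q \<longrightarrow> (\<forall>z. poly P (t + w * z) \<notin> q)) \<and> (range (poly P) \<subseteq> q \<longrightarrow> w \<in> q)"

text \<open>\<open>Q p\<close> is a modulus that P avoids at the point \<open>u p\<close>. Choosing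
  t congruent to \<open>u p\<close> and \<open>w\<close> in \<open>Q p\<close> makes every t + wz
  congruent to \<open>u p\<close>, so P(t + wz) avoids \<open>Q p\<close> and any \<open>q\<close>
  inside it. A remaining \<open>q\<close> contains all values of P and also \<open>Q p\<close>,
  hence \<open>w\<close>.\<close>

lemma adjust_residue_class:
  fixes P :: "'a::idom poly"
  assumes "finite S"
    and S: "\<And>p. p \<in> S \<Longrightarrow> primeideal p type_ring" "\<And>p x. p \<in> S \<Longrightarrow> x \<notin> p \<Longrightarrow> \<exists>y. 1 - x * y \<in> p"
    and Q: "\<And>p. p \<in> S \<Longrightarrow> ideal (Q p) type_ring" "\<And>p x. p \<in> S \<Longrightarrow> x \<in> p \<Longrightarrow> x ^ K p \<in> Q p"
    and w: "\<And>p. p \<in> S \<Longrightarrow> w \<in> Q p"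
    and u: "\<And>p. p \<in> S \<Longrightarrow> poly P (u p) \<notin> Q p"
    and in_S: "\<And>p q. (p, q) \<in> Fam \<Longrightarrow> p \<in> S \<Longrightarrow> q \<subseteq> Q p \<or> range (poly P) \<subseteq> q \<and> Q p \<subseteq> q"
    and not_in_S: "\<And>p q. (p, q) \<in> Fam \<Longrightarrow> p \<notin> S \<Longrightarrow>
      w \<notin> p \<and> (\<exists>A. card A = N \<and> separated_mod p A)"
  shows "\<exists>t. \<forall>(p, q) \<in> Fam. adjusted_at N P t w p q"
proof -
  have "\<exists>y\<in>Q p'. 1 - y \<in> Q p" if "p \<in> S" "p' \<in> S" "p \<noteq> p'" for p p'
    by (rule comaximal_powers[of p p' "Q p" "K p" "Q p'" "K p'"]) (use that S Q in auto)
  with Q(1) obtain t where t: "\<forall>p\<in>S. t - u p \<in> Q p"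
    using crt_ideals[OF \<open>finite S\<close>, of Q u] by blast
  have "adjusted_at N P t w p q" if pq: "(p, q) \<in> Fam" for p q
  proof (cases "p \<in> S")
    case True
    note id = Q(1)[OF True]
    have not_in: "poly P (t + w * z) \<notin> Q p" for z
    proof
      assume *: "poly P (t + w * z) \<in> Q p"
      have "t + w * z - u p = (t - u p) + w * z" by simp
      moreover have "\<dots> \<in> Q p"
        using t True w by (intro ideal_add[OF id] ideal_mult_right[OF id]) auto
      ultimately have "t + w * z - u p \<in> Q p" by (simp only:)
      then have "poly P (t + w * z) - poly P (u p) \<in> Q p" by (rule poly_diff_mem[OF id])
      from ideal_diff[OF id * this] u[OF True] show False by simp
    qed
    have "q \<subseteq> Q p \<Longrightarrow> \<not> range (poly P) \<subseteq> q" using u[OF True] by auto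
    then show ?thesis
      unfolding adjusted_at_def using in_S[OF pq True] not_in w[OF True] by blast
  qed (use not_in_S[OF pq] in \<open>auto simp: adjusted_at_def\<close>)
  then show ?thesis by auto
qed

section \<open>Near UFDs\<close>

text \<open>Associated primes have the same multiples, so each principal prime ideal is the image of
  one of the finitely many classes modulo units.\<close>

lemma near_ufd_finite_primes:
  assumes "near_ufd TYPE('a::idom)" "(a :: 'a) \<noteq> 0"
  shows "finite {{x. c dvd x} |c. prime_elem c \<and> c dvd a}"
proof (rule finite_subset)
  let ?r = "{(p, q). \<exists>u::'a. u dvd 1 \<and> q = u * p}"
  let ?X = "{p. prime_elem p \<and> p dvd a}"
  show "finite ((\<lambda>C. {x. \<exists>c\<in>C. c dvd x}) ` (?X // ?r))"
    using assms unfolding near_ufd_def by blast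
  show "{{x. c dvd x} |c. prime_elem c \<and> c dvd a} \<subseteq> (\<lambda>C. {x. \<exists>c\<in>C. c dvd x}) ` (?X // ?r)"
  proof safe
    fix c assume c: "prime_elem c" "c dvd a"
    have "?r `` {c} \<in> ?X // ?r" using c by (intro quotientI) simp
    moreover have "{x. c dvd x} = {x. \<exists>d\<in>?r `` {c}. d dvd x}"
    proof (intro equalityI subsetI CollectI)
      fix x assume "x \<in> {x. c dvd x}"
      then show "\<exists>d\<in>?r `` {c}. d dvd x" by (intro bexI[of _ c]) (auto intro: exI[of _ 1])
    qed (auto dest: dvd_mult_right)
    ultimately show "{x. c dvd x} \<in> (\<lambda>C. {x. \<exists>c\<in>C. c dvd x}) ` (?X // ?r)" by blast
  qed
qed

lemma near_ufd_adjust: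
  fixes P :: "'a::idom poly"
  assumes "near_ufd TYPE('a)" "infinite (UNIV :: 'a set)"
    and "\<not> (\<exists>I\<in>Nonunit. range (poly P) \<subseteq> I)"
  shows "\<exists>Fam t w. detects_nonunits Fam \<and> w \<noteq> 0 \<and> (\<forall>(p, q) \<in> Fam. adjusted_at (Suc N) P t w p q)"
proof -
  define Fam where "Fam = {({x. c dvd x}, {x. c dvd x}) |c::'a. prime_elem c}"
  \<comment> \<open>The exceptional primes are those with few residues, not all those containing
    \<open>w0\<close>: only few residues guarantee that a principal prime is maximal. Membership of
    \<open>w0\<close> is used for finiteness.\<close>
  define S where
    "S = {{x. c dvd x} |c::'a. prime_elem c \<and> \<not> (\<exists>A. card A = Suc N \<and> separated_mod {x. c dvd x} A)}"
  obtain w0 :: 'a where w0: "w0 \<noteq> 0"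
    "\<And>p. primeideal p type_ring \<Longrightarrow> w0 \<notin> p \<Longrightarrow> \<exists>A. card A = Suc N \<and> separated_mod p A"
    using separating_element[OF assms(2)] by blast
  have "S \<subseteq> {{x. c dvd x} |c. prime_elem c \<and> c dvd w0}"
    unfolding S_def using w0(2) prime_elem_primeideal by blast
  then have finS: "finite S" using near_ufd_finite_primes[OF assms(1) w0(1)] finite_subset by blast
  have "\<forall>p\<in>S. \<exists>c. prime_elem c \<and> p = {x. c dvd x}" unfolding S_def by blast
  then obtain g where g: "\<And>p. p \<in> S \<Longrightarrow> prime_elem (g p)" "\<And>p. p \<in> S \<Longrightarrow> p = {x. g p dvd x}"
    by metis
  have prime: "primeideal p type_ring" if "p \<in> S" for p
    using g[OF that] prime_elem_primeideal by metis
  \<comment> \<open>\<open>w0\<close> could lie in primes outside \<open>S\<close>. The product of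
    generators does not, since a prime element dividing another one is associated to it.\<close>
  define w where "w = prod g S"
  have w: "w \<noteq> 0" unfolding w_def using finS g(1) by (auto dest: prime_elem_not_zeroI)
  have "\<exists>u. poly P u \<notin> p" if "p \<in> S" for p
  proof -
    have "p \<in> Nonunit" unfolding Nonunit_iff
      using g[OF that] by (metis prime_elem_not_unit prime_elem_not_zeroI)
    then show ?thesis using assms(3) by blast
  qed
  then obtain u where u: "\<And>p. p \<in> S \<Longrightarrow> poly P (u p) \<notin> p" by metis
  have "\<exists>t. \<forall>(p, q) \<in> Fam. adjusted_at (Suc N) P t w p q"
  proof (rule adjust_residue_class[OF finS prime, where Q = "\<lambda>p. p" and K = "\<lambda>_. 1" and u = u])
    fix p x assume p: "p \<in> S" "x \<notin> p"
    show "\<exists>y. 1 - x * y \<in> p"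
      by (rule maximal_if_few_residues[OF prime[OF p(1)] _ p(2), of N]) (use p(1) in \<open>auto simp: S_def\<close>)
  next
    fix p assume p: "p \<in> S"
    have "g p dvd w" unfolding w_def using finS p by (rule dvd_prodI)
    then show "w \<in> p" using g(2)[OF p] by blast
  next
    fix p q assume pq: "(p, q) \<in> Fam" "p \<notin> S"
    then obtain c where c: "prime_elem c" "p = {x. c dvd x}" unfolding Fam_def by blast
    have "w \<notin> p"
      unfolding w_def
    proof (rule primeideal_prod, use c prime_elem_primeideal in blast, rule notI)
      fix p' assume "p' \<in> S" "g p' \<in> p"
      then have p': "p' \<in> S" "c dvd g p'" using c(2) by auto
      then obtain k where k: "g p' = c * k" by blast
      have g0: "g p' \<noteq> 0" using g(1)[OF p'(1)] by auto
      have "g p' dvd c"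
      proof (rule ccontr)
        assume "\<not> g p' dvd c"
        then have "g p' dvd k"
          using g(1)[OF p'(1)] k by (metis dvd_refl prime_elem_dvd_mult_iff)
        then obtain m where m: "k = g p' * m" by blast
        have "g p' * (c * m) = g p' * 1" using k m by (simp add: ac_simps)
        then have "c * m = 1" using g0 mult_left_cancel by blast
        then show False using c(1) by (metis dvd_triv_left prime_elem_not_unit)
      qed
      then have "{x. g p' dvd x} = {x. c dvd x}" using p'(2) dvd_trans by blast
      then show False using g(2)[OF p'(1)] p'(1) c(2) pq(2) by simp
    qed
    then show "w \<notin> p \<and> (\<exists>A. card A = Suc N \<and> separated_mod p A)"
      using pq(2) c unfolding S_def by blast
  qed (use prime u in \<open>auto simp: primeideal_type_ring_iff Fam_def\<close>)
  moreover have "detects_nonunits Fam"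
    unfolding detects_nonunits_def
  proof (intro conjI allI impI)
    show "\<forall>(p, q) \<in> Fam. primary_to p q"
      using prime_elem_primeideal
      by (auto simp: Fam_def primary_to_def ideal_multiples prime_elem_dvd_mult_iff)
    fix A :: "'a set" and c :: 'a assume A: "\<not> (\<exists>I\<in>Nonunit. A \<subseteq> I)" and c: "c \<noteq> 0" "\<not> c dvd 1"
    obtain p where p: "prime_elem p" "p dvd c"
      using assms(1) c unfolding near_ufd_def by blast
    then have "{x. p dvd x} \<in> Nonunit"
      unfolding Nonunit_iff using prime_elem_not_unit prime_elem_not_zeroI by blast
    then have "\<not> A \<subseteq> {x. p dvd x}" using A by blast
    moreover have "({x. p dvd x}, {x. p dvd x}) \<in> Fam" using p by (auto simp: Fam_def)
    ultimately show "\<exists>(p, q) \<in> Fam. c \<in> q \<and> \<not> A \<subseteq> q" using p(2) by blast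
  qed
  ultimately show ?thesis using w by blast
qed

section \<open>Dedekind domains\<close>

text \<open>
  The ideals generated by \<open>x, (b/a)x, \<dots>, (b/a)\<^sup>n x\<close> become stationary, which makes \<open>b/a\<close> integral.
\<close>

lemma dedekind_integral_multiplier:
  fixes a b :: "'a::idom"
  assumes "noetherian_ring (type_ring :: 'a ring)" "integrally_closed TYPE('a)"
    and "a \<noteq> 0" "x \<in> J" "x \<noteq> 0" "\<And>y. y \<in> J \<Longrightarrow> \<exists>z\<in>J. b * y = a * z"
  shows "a dvd b"
proof -
  from assms(6) obtain g where g: "\<And>y. y \<in> J \<Longrightarrow> g y \<in> J" "\<And>y. y \<in> J \<Longrightarrow> b * y = a * g y"
    by metis
  define y where "y n = (g ^^ n) x" for n
  have yJ: "y n \<in> J" for n unfolding y_def by (induction n) (auto simp: assms(4) g(1))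
  have pow: "a ^ n * y n = b ^ n * x" for n
  proof (induction n)
    case (Suc n)
    have "a ^ Suc n * y (Suc n) = a ^ n * (b * y n)" using g(2)[OF yJ[of n]] by (simp add: y_def)
    also have "\<dots> = b ^ Suc n * x" using Suc by (simp add: algebra_simps)
    finally show ?case .
  qed (simp add: y_def)
  \<comment> \<open>The ideal generated by the first n of the elements (b/a)^i x, which all lie in
    \<open>J\<close> and hence in the ring.\<close>
  define I where "I n = {\<Sum>i<n. c i * y i |c. True}" for n :: nat
  have idI: "ideal (I n) type_ring" for n
    unfolding ideal_type_ring_iff
  proof (intro conjI ballI allI)
    show "0 \<in> I n" unfolding I_def by (auto intro!: exI[of _ "\<lambda>_. 0"])
    fix u v assume "u \<in> I n" "v \<in> I n"
    then obtain c d where "u = (\<Sum>i<n. c i * y i)" "v = (\<Sum>i<n. d i * y i)"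
      unfolding I_def by blast
    then have "u + v = (\<Sum>i<n. (c i + d i) * y i)" by (simp add: algebra_simps sum.distrib)
    then show "u + v \<in> I n" unfolding I_def by (auto intro!: exI[of _ "\<lambda>i. c i + d i"])
  next
    fix u r assume "u \<in> I n"
    then obtain c where "u = (\<Sum>i<n. c i * y i)" unfolding I_def by blast
    then have "r * u = (\<Sum>i<n. (r * c i) * y i)" by (simp add: sum_distrib_left mult.assoc)
    then show "r * u \<in> I n" unfolding I_def by (auto intro!: exI[of _ "\<lambda>i. r * c i"])
  qed
  have "\<exists>M\<in>range I. \<forall>J\<in>range I. M \<subseteq> J \<longrightarrow> J = M"
    by (rule noetherian_maximal_element[OF assms(1)]) (use idI in auto)
  then obtain n where n: "\<And>m. I n \<subseteq> I m \<Longrightarrow> I m = I n" by auto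
  have "I n \<subseteq> I (Suc n)"
  proof
    fix u assume "u \<in> I n"
    then obtain c where "u = (\<Sum>i<n. c i * y i)" unfolding I_def by blast
    then have "u = (\<Sum>i<Suc n. (c(n := 0)) i * y i)" by simp
    then show "u \<in> I (Suc n)" unfolding I_def mem_Collect_eq by (intro exI[of _ "c(n := 0)"]) simp
  qed
  with n have "I (Suc n) = I n" by blast
  moreover have "y n = (\<Sum>i<Suc n. (if i = n then 1 else 0) * y i)" by simp
  then have "y n \<in> I (Suc n)"
    unfolding I_def mem_Collect_eq by (intro exI[of _ "\<lambda>i. if i = n then 1 else 0"]) simp
  ultimately obtain c where c: "y n = (\<Sum>i<n. c i * y i)" unfolding I_def by blast
  \<comment> \<open>Over the fraction field \<open>y i\<close> is (b/a)^i x, so the relation for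
    \<open>y n\<close> says that x times the value of this monic polynomial at b/a is 0.\<close>
  define f where "f = Polynomial.monom 1 n - (\<Sum>i<n. Polynomial.monom (c i) i)"
  have coeff_f: "Polynomial.coeff f k = (if k = n then 1 else 0) - (if k < n then c k else 0)" for k
  proof -
    have "(\<Sum>i<n. if i = k then c i else 0) = (if k < n then c k else 0)"
      by (simp add: sum.delta)
    then show ?thesis by (simp add: f_def coeff_sum)
  qed
  have "Polynomial.degree f = n"
    by (rule antisym[OF degree_le le_degree]) (auto simp: coeff_f)
  then have lead: "lead_coeff f = 1" by (simp add: coeff_f)
  let ?q = "to_fract b / to_fract a"
  have hom: "type_hom (to_fract :: 'a \<Rightarrow> 'a fract)" by (rule type_hom_to_fract)
  have ne: "to_fract a \<noteq> 0" "to_fract x \<noteq> 0" using assms(3,5) by auto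
  have y_frac: "to_fract (y i) = ?q ^ i * to_fract x" for i
  proof -
    have "to_fract (a ^ i * y i) = to_fract (b ^ i * x)" by (simp only: pow)
    then show ?thesis
      using ne by (simp add: type_hom_mult[OF hom] type_hom_power[OF hom] field_simps)
  qed
  have "poly (fract_poly f) ?q * to_fract x = 0"
  proof -
    have "poly (fract_poly f) ?q = (\<Sum>k\<le>n. to_fract (Polynomial.coeff f k) * ?q ^ k)"
      by (simp add: poly_altdef coeff_map_poly degree_map_poly \<open>Polynomial.degree f = n\<close>)
    also have "{..n} = insert n {..<n}" by auto
    also have "(\<Sum>k\<in>insert n {..<n}. to_fract (Polynomial.coeff f k) * ?q ^ k)
        = ?q ^ n - (\<Sum>k<n. to_fract (c k) * ?q ^ k)"
      by (simp add: coeff_f sum_negf type_hom_uminus[OF hom])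
    finally have "poly (fract_poly f) ?q = ?q ^ n - (\<Sum>k<n. to_fract (c k) * ?q ^ k)" .
    then have "poly (fract_poly f) ?q * to_fract x
        = to_fract (y n) - (\<Sum>k<n. to_fract (c k) * to_fract (y k))"
      unfolding y_frac by (simp only: left_diff_distrib sum_distrib_right mult.assoc)
    also have "\<dots> = 0"
      by (subst c) (simp add: type_hom_sum[OF hom] type_hom_mult[OF hom])
    finally show ?thesis .
  qed
  then have "poly (fract_poly f) ?q = 0" using ne by simp
  then obtain z where "?q = to_fract z"
    using assms(2) lead unfolding integrally_closed_def by blast
  then have "to_fract b = to_fract (a * z)"
    using ne by (simp add: type_hom_mult[OF hom] field_simps)
  then show ?thesis by (simp only: to_fract_eq_iff dvd_triv_left)
qed

locale dedekind_prime =
  fixes p :: "'a::idom set"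
  assumes dedekind: "dedekind_domain TYPE('a)"
    and prime: "primeideal p type_ring" and nonzero: "p \<noteq> {0}"
begin

lemma noetherian: "noetherian_ring (type_ring :: 'a ring)"
  and closed: "integrally_closed TYPE('a)"
  and max: "primeideal P type_ring \<Longrightarrow> P \<noteq> {0} \<Longrightarrow> maximalideal P (type_ring :: 'a ring)"
  using dedekind by (auto simp: dedekind_domain_def)

lemma id: "ideal p type_ring" and one_notin: "1 \<notin> p"
  and prime_mult: "x * y \<in> p \<Longrightarrow> x \<in> p \<or> y \<in> p"
  using prime by (auto simp: primeideal_type_ring_iff)

text \<open>
  With \<open>b p \<subseteq> (a)\<close> and \<open>b \<notin> (a)\<close>, the element \<open>b/a\<close> maps \<open>p\<close> into the ring but not into \<open>p\<close>
  by the previous lemma; any \<open>\<pi> \<in> p\<close> with \<open>(b/a)\<pi> \<notin> p\<close> is a local generator.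
\<close>

lemma uniformizer: "\<exists>\<pi>\<in>p. \<forall>x\<in>p. \<exists>s. s \<notin> p \<and> \<pi> dvd s * x"
proof -
  obtain a where a: "a \<in> p" "a \<noteq> 0" using nonzero ideal_zero[OF id] by blast
  \<comment> \<open>The contraction to the ring of the ideal generated by a in the localization at
    \<open>p\<close>. For b outside it the quotient ideal (a : b) is contained in \<open>p\<close>;
    a maximal one is prime, as associated primes are, and nonzero because it contains a, hence it
    equals \<open>p\<close>.\<close>
  define q where "q = {x. \<exists>s. s \<notin> p \<and> a dvd s * x}"
  let ?J = "\<lambda>b. {x. a dvd b * x}"
  have idJ: "ideal (?J b) type_ring" for b
    by (auto simp: ideal_type_ring_iff distrib_left mult.left_commute)
  have "1 \<notin> q" unfolding q_def using ideal_dvd[OF id a(1)] by auto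
  then have "?J ` (- q) \<noteq> {}" by blast
  with idJ have "\<exists>M\<in>?J ` (- q). \<forall>I\<in>?J ` (- q). M \<subseteq> I \<longrightarrow> I = M"
    by (intro noetherian_maximal_element[OF noetherian]) auto
  then obtain b where b: "b \<notin> q" and b_max: "\<And>b'. b' \<notin> q \<Longrightarrow> ?J b \<subseteq> ?J b' \<Longrightarrow> ?J b' = ?J b"
    by blast
  have aJ: "a \<in> ?J b" by simp
  have Jp: "?J b \<subseteq> p"
  proof
    fix x assume "x \<in> ?J b"
    then show "x \<in> p" using b unfolding q_def by (auto simp: mult.commute)
  qed
  have "primeideal (?J b) type_ring"
    unfolding primeideal_type_ring_iff
  proof (intro conjI idJ allI impI)
    show "1 \<notin> ?J b" using Jp one_notin by blast
    fix x y assume xy: "x * y \<in> ?J b"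
    show "x \<in> ?J b \<or> y \<in> ?J b"
    \<comment> \<open>Either b can be replaced by \<open>b * s\<close>, whose quotient ideal
      contains y, or by \<open>b * y\<close>, whose quotient ideal contains x. By maximality the
      quotient ideal does not change.\<close>
    proof (cases "b * y \<in> q")
      case True
      then obtain s where s: "s \<notin> p" "a dvd s * (b * y)" unfolding q_def by blast
      have "b * s \<notin> q"
      proof
        assume "b * s \<in> q"
        then obtain s' where "s' \<notin> p" "a dvd s' * (b * s)" unfolding q_def by blast
        then have "s' * s \<notin> p" "a dvd (s' * s) * b" using s(1) prime_mult by (auto simp: ac_simps)
        then show False using b unfolding q_def by blast
      qed
      moreover have "?J b \<subseteq> ?J (b * s)"
      proof
        fix x assume "x \<in> ?J b"
        then have "a dvd (b * x) * s" by simp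
        then show "x \<in> ?J (b * s)" by (simp add: ac_simps)
      qed
      ultimately have "?J (b * s) = ?J b" by (rule b_max)
      moreover have "y \<in> ?J (b * s)" using s(2) by (simp add: ac_simps)
      ultimately show ?thesis by blast
    next
      case False
      moreover have "?J b \<subseteq> ?J (b * y)"
      proof
        fix x assume "x \<in> ?J b"
        then have "a dvd (b * x) * y" by simp
        then show "x \<in> ?J (b * y)" by (simp add: ac_simps)
      qed
      ultimately have "?J (b * y) = ?J b" by (rule b_max)
      moreover have "x \<in> ?J (b * y)" using xy by (simp add: ac_simps)
      ultimately show ?thesis by blast
    qed
  qed
  moreover have "?J b \<noteq> {0}" using aJ a(2) by blast
  ultimately have "maximalideal (?J b) type_ring" by (rule max)
  then have "p = ?J b \<or> p = UNIV"
    using maximalideal.I_maximal[OF _ id Jp] by simp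
  then have J: "?J b = p" using one_notin by blast
  have "\<not> a dvd b"
  proof
    assume "a dvd b"
    then have "1 \<in> ?J b" by simp
    then show False using J one_notin by simp
  qed
  then obtain \<pi> where \<pi>: "\<pi> \<in> p" "\<not> (\<exists>z\<in>p. b * \<pi> = a * z)"
    using dedekind_integral_multiplier[OF noetherian closed a(2,1,2)] by blast
  then obtain s where s: "b * \<pi> = a * s" using J by blast
  with \<pi>(2) have sp: "s \<notin> p" by blast
  have "\<pi> dvd s * x" if "x \<in> p" for x
  proof -
    from that J obtain r where r: "b * x = a * r" by blast
    have "a * (s * x) = (b * \<pi>) * x" by (simp add: s mult.assoc)
    also have "\<dots> = a * (\<pi> * r)" by (metis r mult.assoc mult.left_commute)
    finally have "s * x = \<pi> * r" using a(2) by simp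
    then show ?thesis by simp
  qed
  with \<pi>(1) sp show ?thesis by blast
qed

text \<open>If x were locally divisible by all powers of \<open>\<pi>\<close>, consider the
  ascending ideals (x : \<open>\<pi>\<close>^k), taken locally. They become stationary at some k.
  Writing s x = \<open>\<pi>\<close>^(k+1) y, the element y lies in the ideal for k + 1, hence in
  the one for k; cancelling x then makes a product of elements outside \<open>p\<close> a multiple
  of \<open>\<pi>\<close>.\<close>

lemma ex_order:
  assumes \<pi>: "\<pi> \<in> p" "\<pi> \<noteq> 0" and "x \<noteq> 0"
  shows "\<exists>k. \<not> (\<exists>s. s \<notin> p \<and> \<pi> ^ Suc k dvd s * x)"
proof (rule ccontr)
  assume neg: "\<not> ?thesis"
  define K where "K k = {z. \<exists>s. s \<notin> p \<and> x dvd s * z * \<pi> ^ k}" for k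
  have idK: "ideal (K k) type_ring" for k
    unfolding ideal_type_ring_iff
  proof (intro conjI ballI allI)
    show "0 \<in> K k" unfolding K_def using one_notin by auto
    fix u v assume "u \<in> K k" "v \<in> K k"
    then obtain s s' where s: "s \<notin> p" "x dvd s * u * \<pi> ^ k" and s': "s' \<notin> p" "x dvd s' * v * \<pi> ^ k"
      unfolding K_def by blast
    have "s * s' * (u + v) * \<pi> ^ k = s' * (s * u * \<pi> ^ k) + s * (s' * v * \<pi> ^ k)"
      by (simp add: algebra_simps)
    then have "x dvd s * s' * (u + v) * \<pi> ^ k" using s(2) s'(2) by simp
    moreover have "s * s' \<notin> p" using s(1) s'(1) prime_mult by blast
    ultimately show "u + v \<in> K k" unfolding K_def by blast
  next
    fix u r assume "u \<in> K k"
    then obtain s where s: "s \<notin> p" "x dvd s * u * \<pi> ^ k" unfolding K_def by blast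
    then have "x dvd r * (s * u * \<pi> ^ k)" by simp
    then have "x dvd s * (r * u) * \<pi> ^ k" by (simp add: ac_simps)
    then show "r * u \<in> K k" unfolding K_def using s(1) by blast
  qed
  have "\<exists>M\<in>range K. \<forall>J\<in>range K. M \<subseteq> J \<longrightarrow> J = M"
    by (rule noetherian_maximal_element[OF noetherian]) (use idK in auto)
  then obtain k where k: "\<And>m. K k \<subseteq> K m \<Longrightarrow> K m = K k" by auto
  have "K k \<subseteq> K (Suc k)"
  proof
    fix z assume "z \<in> K k"
    then obtain s where s: "s \<notin> p" "x dvd s * z * \<pi> ^ k" unfolding K_def by blast
    then have "x dvd \<pi> * (s * z * \<pi> ^ k)" by simp
    then show "z \<in> K (Suc k)" unfolding K_def using s(1) by (auto simp: ac_simps)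
  qed
  with k have K: "K (Suc k) = K k" by blast
  from neg obtain s y where s: "s \<notin> p" "s * x = \<pi> ^ Suc k * y" by (metis dvdE)
  have "1 * y * \<pi> ^ Suc k = s * x" using s(2) by (simp only: mult_1_left mult.commute)
  then have "x dvd 1 * y * \<pi> ^ Suc k" by (simp only: dvd_triv_right)
  then have "y \<in> K (Suc k)" unfolding K_def using one_notin by blast
  then have "y \<in> K k" using K by simp
  then obtain s' r where s': "s' \<notin> p" "s' * y * \<pi> ^ k = x * r" unfolding K_def by blast
  have "x * (s' * s) = s' * (s * x)" by (simp add: ac_simps)
  also have "\<dots> = \<pi> * (s' * y * \<pi> ^ k)" by (simp add: s(2) ac_simps)
  also have "\<dots> = x * (r * \<pi>)" by (subst s'(2)) (simp add: ac_simps)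
  finally have "s' * s = r * \<pi>" using assms(3) by simp
  then have "s' * s \<in> p" using ideal_mult_left[OF id \<pi>(1)] by simp
  then show False using s(1) s'(1) prime_mult by blast
qed

text \<open>Let \<open>V k\<close> be the elements of order at least k at \<open>p\<close>, with k
  the least order occurring in \<open>A\<close>; then \<open>Q\<close> is \<open>V (Suc k)\<close>
  and x has exact order k. A primary \<open>q\<close> containing \<open>\<pi> ^ k\<close> contains
  \<open>V k\<close>, hence \<open>A\<close> and \<open>Q\<close>. Any other \<open>q\<close>
  contains no element of order at most k. The exponent of the statement is
  \<open>Suc k\<close>.\<close>

lemma local_generator:
  assumes "A \<noteq> {}" "A \<noteq> {0}"
  shows "\<exists>Q x k. x \<in> A \<and> x \<notin> Q \<and> ideal Q type_ring \<and> (\<forall>y\<in>p. y ^ k \<in> Q) \<and>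
    (\<forall>q. primary_to p q \<longrightarrow> q \<subseteq> Q \<or> A \<subseteq> q \<and> Q \<subseteq> q)"
proof -
  obtain \<pi> where \<pi>: "\<pi> \<in> p" "\<And>x. x \<in> p \<Longrightarrow> \<exists>s. s \<notin> p \<and> \<pi> dvd s * x"
    using uniformizer by blast
  obtain a where a: "a \<in> p" "a \<noteq> 0" using nonzero ideal_zero[OF id] by blast
  have \<pi>0: "\<pi> \<noteq> 0"
    using \<pi>(2)[OF a(1)] a(2) ideal_zero[OF id] by auto
  define V where "V k = {x. \<exists>s. s \<notin> p \<and> \<pi> ^ k dvd s * x}" for k
  have idV: "ideal (V k) type_ring" for k
    unfolding ideal_type_ring_iff
  proof (intro conjI ballI allI)
    show "0 \<in> V k" unfolding V_def using one_notin by auto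
    fix u v assume "u \<in> V k" "v \<in> V k"
    then obtain s s' where s: "s \<notin> p" "\<pi> ^ k dvd s * u" and s': "s' \<notin> p" "\<pi> ^ k dvd s' * v"
      unfolding V_def by blast
    have "s * s' * (u + v) = s' * (s * u) + s * (s' * v)" by (simp add: algebra_simps)
    then have "\<pi> ^ k dvd s * s' * (u + v)" using s(2) s'(2) by simp
    moreover have "s * s' \<notin> p" using s(1) s'(1) prime_mult by blast
    ultimately show "u + v \<in> V k" unfolding V_def by blast
  next
    fix u r assume "u \<in> V k"
    then obtain s where s: "s \<notin> p" "\<pi> ^ k dvd s * u" unfolding V_def by blast
    then have "\<pi> ^ k dvd r * (s * u)" by simp
    then have "\<pi> ^ k dvd s * (r * u)" by (simp add: ac_simps)
    then show "r * u \<in> V k" unfolding V_def using s(1) by blast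
  qed
  have V_power: "y ^ k \<in> V k" if y: "y \<in> p" for y k
  proof -
    obtain s where s: "s \<notin> p" "\<pi> dvd s * y" using \<pi>(2)[OF y] by blast
    then have "\<pi> ^ k dvd s ^ k * y ^ k" using dvd_power_same[of \<pi> "s * y" k] by (simp add: power_mult_distrib)
    then show ?thesis unfolding V_def using primeideal_power[OF prime s(1)] by blast
  qed
  have V_subset: "V j \<subseteq> q" if "primary_to p q" "\<pi> ^ j \<in> q" for j q
  proof
    fix x assume "x \<in> V j"
    then obtain s where s: "s \<notin> p" "\<pi> ^ j dvd s * x" unfolding V_def by blast
    then have "s * x \<in> q" using ideal_dvd[OF primary_to_ideal[OF that(1)] that(2)] by blast
    then show "x \<in> q" using that(1) s(1) unfolding primary_to_def by blast
  qed
  have unit_part: "\<exists>s u. s \<notin> p \<and> u \<notin> p \<and> s * x = \<pi> ^ k * u" if x: "x \<in> V k" "x \<notin> V (Suc k)" for x k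
  proof -
    obtain s u where s: "s \<notin> p" "s * x = \<pi> ^ k * u" using x(1) unfolding V_def by blast
    have "u \<notin> p"
    proof
      assume "u \<in> p"
      then obtain s' where s': "s' \<notin> p" "\<pi> dvd s' * u" using \<pi>(2) by blast
      have "s' * s * x = \<pi> ^ k * (s' * u)" using s(2) by (simp add: ac_simps)
      moreover have "\<pi> ^ k * \<pi> dvd \<pi> ^ k * (s' * u)" by (rule mult_dvd_mono[OF dvd_refl s'(2)])
      ultimately have "\<pi> ^ Suc k dvd s' * s * x" by (simp only: power_Suc2)
      moreover have "s' * s \<notin> p" using s(1) s'(1) prime_mult by blast
      ultimately show False using x(2) unfolding V_def by blast
    qed
    with s show ?thesis by blast
  qed
  have "\<exists>x\<in>A. x \<noteq> 0" using assms by auto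
  then have ex: "\<exists>k. \<exists>x\<in>A. x \<notin> V (Suc k)"
    using ex_order[OF \<pi>(1) \<pi>0] unfolding V_def by blast
  define k where "k = (LEAST k. \<exists>x\<in>A. x \<notin> V (Suc k))"
  obtain x where x: "x \<in> A" "x \<notin> V (Suc k)" using LeastI_ex[OF ex] unfolding k_def by blast
  have A: "A \<subseteq> V k"
  proof (cases k)
    case 0
    then show ?thesis unfolding V_def using one_notin by auto
  next
    case (Suc j)
    then show ?thesis using not_less_Least[of j "\<lambda>k. \<exists>x\<in>A. x \<notin> V (Suc k)"] k_def by auto
  qed
  have "q \<subseteq> V (Suc k) \<or> A \<subseteq> q \<and> V (Suc k) \<subseteq> q" if q: "primary_to p q" for q
  proof (cases "\<pi> ^ k \<in> q")
    case True
    moreover from True have "\<pi> ^ Suc k \<in> q" using ideal_mult_left[OF primary_to_ideal[OF q]] by simp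
    ultimately show ?thesis using V_subset[OF q] A by blast
  next
    case False
    have "q \<subseteq> V (Suc k)"
    proof (rule ccontr)
      assume "\<not> q \<subseteq> V (Suc k)"
      then obtain z where z: "z \<in> q" "z \<notin> V (Suc k)" by blast
      define j where "j = (LEAST j. z \<notin> V (Suc j))"
      have j: "z \<notin> V (Suc j)" unfolding j_def using z(2) by (rule LeastI)
      have jk: "j \<le> k" unfolding j_def using z(2) by (rule Least_le)
      have "z \<in> V j"
      proof (cases j)
        case 0
        then show ?thesis unfolding V_def using one_notin by auto
      next
        case (Suc i)
        then show ?thesis using not_less_Least[of i "\<lambda>j. z \<notin> V (Suc j)"] j_def by auto
      qed
      \<comment> \<open>An element of exact order j is locally \<open>\<pi> ^ j\<close> times a
        unit; being primary, \<open>q\<close> then contains \<open>\<pi> ^ j\<close> and, as j is at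
        most k, also \<open>\<pi> ^ k\<close>.\<close>
      from unit_part[OF this j] obtain s u where su: "u \<notin> p" "s * z = \<pi> ^ j * u" by blast
      then have "u * \<pi> ^ j \<in> q" using ideal_mult_left[OF primary_to_ideal[OF q] z(1), of s]
        by (simp add: mult.commute)
      then have "\<pi> ^ j \<in> q" using q su(1) unfolding primary_to_def by blast
      then have "\<pi> ^ k \<in> q" using ideal_dvd[OF primary_to_ideal[OF q]] le_imp_power_dvd[OF jk] by blast
      then show False using False by contradiction
    qed
    then show ?thesis by blast
  qed
  then show ?thesis using x idV V_power by blast
qed

end

lemma ideal_add_multiples:
  assumes "ideal I (type_ring :: 'a::comm_ring_1 ring)"
  shows "ideal {u + r * a |u r. u \<in> I} type_ring"
  unfolding ideal_type_ring_iff
proof (intro conjI ballI allI)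
  show "0 \<in> {u + r * a |u r. u \<in> I}"
    using ideal_zero[OF assms] by (intro CollectI exI[of _ 0]) simp
  fix x y assume "x \<in> {u + r * a |u r. u \<in> I}" "y \<in> {u + r * a |u r. u \<in> I}"
  then obtain u r v s where "x = u + r * a" "y = v + s * a" "u \<in> I" "v \<in> I" by blast
  then have "x + y = (u + v) + (r + s) * a" "u + v \<in> I"
    using ideal_add[OF assms] by (auto simp: algebra_simps)
  then show "x + y \<in> {u + r * a |u r. u \<in> I}" by blast
next
  fix x t assume "x \<in> {u + r * a |u r. u \<in> I}"
  then obtain u r where "x = u + r * a" "u \<in> I" by blast
  then have "t * x = t * u + (t * r) * a" "t * u \<in> I"
    using ideal_mult_left[OF assms] by (auto simp: distrib_left mult.assoc)
  then show "t * x \<in> {u + r * a |u r. u \<in> I}" by blast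
qed

text \<open>Noetherian induction: if \<open>a * b \<in> I\<close> then a prime above \<open>I\<close> lies above \<open>I + (a)\<close> or \<open>I + (b)\<close>.\<close>

lemma dedekind_finite_primes:
  assumes "dedekind_domain TYPE('a::idom)" "(w :: 'a) \<noteq> 0"
  shows "finite {p. primeideal p type_ring \<and> w \<in> p}"
proof -
  let ?V = "\<lambda>I::'a set. {p. primeideal p type_ring \<and> I \<subseteq> p}"
  have noeth: "noetherian_ring (type_ring :: 'a ring)"
    using assms(1) by (simp add: dedekind_domain_def)
  have "finite (?V I)" if "ideal I type_ring" "w \<in> I" for I
  proof (rule ccontr)
    assume "infinite (?V I)"
    let ?C = "{I. ideal I type_ring \<and> w \<in> I \<and> infinite (?V I)}"
    have "?C \<noteq> {}" using that \<open>infinite (?V I)\<close> by blast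
    then have "\<exists>M\<in>?C. \<forall>I\<in>?C. M \<subseteq> I \<longrightarrow> I = M"
      by (rule noetherian_maximal_element[OF noeth]) blast
    then obtain M where M: "ideal M type_ring" "w \<in> M" "infinite (?V M)"
      and M_max: "\<And>I. ideal I type_ring \<Longrightarrow> w \<in> I \<Longrightarrow> infinite (?V I) \<Longrightarrow> M \<subseteq> I \<Longrightarrow> I = M"
      by blast
    have "M \<noteq> {0}" using M(2) assms(2) by blast
    have "1 \<notin> M"
    proof
      assume "1 \<in> M"
      then have "?V M = {}" by (auto simp: primeideal_type_ring_iff)
      then show False using M(3) by (metis finite.emptyI)
    qed
    \<comment> \<open>A nonzero prime is maximal and would be the only prime above itself.\<close>
    have "\<not> primeideal M type_ring"
    proof
      assume "primeideal M type_ring"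
      then have max: "maximalideal M type_ring"
        using assms(1) \<open>M \<noteq> {0}\<close> by (auto simp: dedekind_domain_def)
      have "?V M \<subseteq> {M, UNIV}"
        using maximalideal.I_maximal[OF max] by (auto simp: primeideal_type_ring_iff)
      then show False using M(3) finite_subset by blast
    qed
    then obtain a b where ab: "a * b \<in> M" "a \<notin> M" "b \<notin> M"
      using M(1) \<open>1 \<notin> M\<close> unfolding primeideal_type_ring_iff by blast
    have fin: "finite (?V {u + r * c |u r. u \<in> M})" if "c \<notin> M" for c
    proof (rule ccontr)
      let ?I = "{u + r * c |u r. u \<in> M}"
      assume inf: "infinite (?V ?I)"
      have sub: "M \<subseteq> ?I"
      proof
        fix u assume "u \<in> M"
        then show "u \<in> ?I" by (intro CollectI exI[of _ u] exI[of _ 0]) simp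
      qed
      with M(2) have "w \<in> ?I" by blast
      from M_max[OF ideal_add_multiples[OF M(1)] this inf sub] have "?I = M" .
      moreover have "c \<in> ?I"
        using ideal_zero[OF M(1)] by (intro CollectI exI[of _ 0] exI[of _ 1]) simp
      ultimately show False using that by blast
    qed
    have above: "{u + r * c |u r. u \<in> M} \<subseteq> p" if "ideal p type_ring" "M \<subseteq> p" "c \<in> p" for p c
      using that ideal_add[OF that(1)] ideal_mult_left[OF that(1)] by blast
    have "?V M \<subseteq> ?V {u + r * a |u r. u \<in> M} \<union> ?V {u + r * b |u r. u \<in> M}"
    proof
      fix p assume "p \<in> ?V M"
      then have p: "primeideal p type_ring" "M \<subseteq> p" by auto
      then have id: "ideal p type_ring" by (simp add: primeideal_type_ring_iff)
      have "a \<in> p \<or> b \<in> p" using p ab(1) unfolding primeideal_type_ring_iff by blast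
      then show "p \<in> ?V {u + r * a |u r. u \<in> M} \<union> ?V {u + r * b |u r. u \<in> M}"
      proof
        assume "a \<in> p"
        from above[OF id p(2) this] p(1) show ?thesis by (intro UnI1 CollectI conjI)
      next
        assume "b \<in> p"
        from above[OF id p(2) this] p(1) show ?thesis by (intro UnI2 CollectI conjI)
      qed
    qed
    from finite_subset[OF this finite_UnI[OF fin[OF ab(2)] fin[OF ab(3)]]] M(3) show False by contradiction
  qed
  from this[OF ideal_multiples[of w]] have "finite (?V {x. w dvd x})" by simp
  moreover have "{p. primeideal p type_ring \<and> w \<in> p} \<subseteq> ?V {x. w dvd x}"
    using ideal_dvd unfolding primeideal_type_ring_iff by blast
  ultimately show ?thesis by (rule rev_finite_subset)
qed

text \<open>An ideal \<open>q\<close> that is maximal among those avoiding \<open>x\<close> is primary to the prime \<open>(q : x)\<close>.\<close>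

lemma noetherian_primary_avoiding:
  assumes "noetherian_ring (type_ring :: 'a::comm_ring_1 ring)"
    and "ideal I (type_ring :: 'a ring)" "x \<notin> I"
  shows "\<exists>p q. primeideal p type_ring \<and> primary_to p q \<and> I \<subseteq> q \<and> q \<subseteq> p \<and> x \<notin> q"
proof -
  let ?C = "{q. ideal q type_ring \<and> I \<subseteq> q \<and> x \<notin> q}"
  have "?C \<noteq> {}" using assms by blast
  then have "\<exists>M\<in>?C. \<forall>q\<in>?C. M \<subseteq> q \<longrightarrow> q = M"
    by (rule noetherian_maximal_element[OF assms(1)]) blast
  then obtain q where "q \<in> ?C" and C_max: "\<forall>q'\<in>?C. q \<subseteq> q' \<longrightarrow> q' = q" by (elim bexE)
  then have q: "ideal q type_ring" "I \<subseteq> q" "x \<notin> q" by simp_all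
  have q_max: "q' = q" if "ideal q' type_ring" "I \<subseteq> q'" "x \<notin> q'" "q \<subseteq> q'" for q'
    using C_max that by simp
  define p where "p = {a. a * x \<in> q}"
  have idp: "ideal p type_ring"
    using q(1) by (auto simp: ideal_type_ring_iff p_def distrib_right mult.assoc)
  \<comment> \<open>If b is not in \<open>q\<close>, maximality puts x into q + (b). Multiplying by
    a brings a x into \<open>q\<close>, contrary to a being outside (q : x).\<close>
  have prim: "b \<in> q" if "a * b \<in> q" "a \<notin> p" for a b
  proof (rule ccontr)
    assume b: "b \<notin> q"
    let ?q = "{u + r * b |u r. u \<in> q}"
    have sub: "q \<subseteq> ?q"
    proof
      fix u assume "u \<in> q"
      then show "u \<in> ?q" by (intro CollectI exI[of _ u] exI[of _ 0]) simp
    qed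
    have "b \<in> ?q" using ideal_zero[OF q(1)] by (intro CollectI exI[of _ 0] exI[of _ 1]) simp
    then have "?q \<noteq> q" using b by blast
    then have "x \<in> ?q" using q_max[OF ideal_add_multiples[OF q(1)]] sub q(2) by blast
    then obtain u r where ur: "x = u + r * b" "u \<in> q" by blast
    have "a * x = a * u + r * (a * b)" using ur(1) by (simp add: algebra_simps)
    moreover have "a * u + r * (a * b) \<in> q"
      by (rule ideal_add[OF q(1) ideal_mult_left[OF q(1) ur(2)] ideal_mult_left[OF q(1) that(1)]])
    ultimately show False using that(2) unfolding p_def by simp
  qed
  have "q \<subseteq> p" unfolding p_def using ideal_mult_right[OF q(1)] by blast
  moreover have "primary_to p q" using q(1) prim by (auto simp: primary_to_def)
  moreover have "primeideal p type_ring"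
    unfolding primeideal_type_ring_iff
  proof (intro conjI idp allI impI)
    show "1 \<notin> p" using q(3) by (simp add: p_def)
    fix a b assume "a * b \<in> p"
    then have "a * (b * x) \<in> q" by (simp add: p_def mult.assoc)
    then show "a \<in> p \<or> b \<in> p" using prim[of a "b * x"] by (auto simp: p_def)
  qed
  ultimately show ?thesis using q by blast
qed

text \<open>Nonzero primes are already maximal, so all primes containing \<open>w0\<close> may be
  treated as exceptional and a power product of \<open>w0\<close> serves as \<open>w\<close>: it
  avoids every other prime. The family detects nonunits because an element of \<open>A\<close>
  outside (c) is avoided by a primary ideal above (c).\<close>

lemma dedekind_adjust:
  fixes P :: "'a::idom poly"
  assumes "dedekind_domain TYPE('a)" "infinite (UNIV :: 'a set)"
    and "\<not> range (poly P) \<subseteq> {0}"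
  shows "\<exists>Fam t w. detects_nonunits Fam \<and> w \<noteq> 0 \<and> (\<forall>(p, q) \<in> Fam. adjusted_at (Suc N) P t w p q)"
proof -
  define Fam where "Fam = {(p, q). primeideal p (type_ring :: 'a ring) \<and> p \<noteq> {0} \<and> primary_to p q}"
  obtain w0 :: 'a where w0: "w0 \<noteq> 0"
    "\<And>p. primeideal p type_ring \<Longrightarrow> w0 \<notin> p \<Longrightarrow> \<exists>A. card A = Suc N \<and> separated_mod p A"
    using separating_element[OF assms(2)] by blast
  define S where "S = {p. primeideal p type_ring \<and> w0 \<in> p}"
  have finS: "finite S" unfolding S_def by (rule dedekind_finite_primes[OF assms(1) w0(1)])
  have S: "primeideal p type_ring" "w0 \<in> p" "p \<noteq> {0}" if "p \<in> S" for p
    using that w0(1) unfolding S_def by auto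
  have "\<exists>Q u k. poly P u \<notin> Q \<and> ideal Q type_ring \<and> (\<forall>y\<in>p. y ^ k \<in> Q) \<and>
    (\<forall>q. primary_to p q \<longrightarrow> q \<subseteq> Q \<or> range (poly P) \<subseteq> q \<and> Q \<subseteq> q)" if "p \<in> S" for p
  proof -
    interpret dedekind_prime p by (rule dedekind_prime.intro[OF assms(1) S(1)[OF that] S(3)[OF that]])
    have "range (poly P) \<noteq> {}" "range (poly P) \<noteq> {0}" using assms(3) by auto
    from local_generator[OF this] show ?thesis by blast
  qed
  then obtain Q u K where Q: "\<And>p. p \<in> S \<Longrightarrow> poly P (u p) \<notin> Q p"
    "\<And>p. p \<in> S \<Longrightarrow> ideal (Q p) type_ring" "\<And>p y. p \<in> S \<Longrightarrow> y \<in> p \<Longrightarrow> y ^ K p \<in> Q p"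
    "\<And>p q. p \<in> S \<Longrightarrow> primary_to p q \<Longrightarrow> q \<subseteq> Q p \<or> range (poly P) \<subseteq> q \<and> Q p \<subseteq> q"
    by metis
  define w where "w = (\<Prod>p\<in>S. w0 ^ K p)"
  have w: "w \<noteq> 0" unfolding w_def using finS w0(1) by simp
  have "\<exists>t. \<forall>(p, q) \<in> Fam. adjusted_at (Suc N) P t w p q"
  proof (rule adjust_residue_class[OF finS S(1), where Q = Q and K = K and u = u])
    fix p x assume p: "p \<in> S" "x \<notin> p"
    have max: "maximalideal p type_ring"
      using assms(1) S[OF p(1)] unfolding dedekind_domain_def by blast
    have id: "ideal p type_ring" using S[OF p(1)] by (simp add: primeideal_type_ring_iff)
    let ?I = "{u + r * x |u r. u \<in> p}"
    have "p \<subseteq> ?I"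
    proof
      fix u assume "u \<in> p"
      then show "u \<in> ?I" by (intro CollectI exI[of _ u] exI[of _ 0]) simp
    qed
    moreover have "x \<in> ?I" using ideal_zero[OF id] by (intro CollectI exI[of _ 0] exI[of _ 1]) simp
    then have "?I \<noteq> p" using p(2) by blast
    ultimately have "?I = UNIV"
      using maximalideal.I_maximal[OF max ideal_add_multiples[OF id, of x]] by simp
    then obtain u r where "1 = u + r * x" "u \<in> p" by blast
    then have "u = 1 - x * r" by (metis add_diff_cancel_right' mult.commute)
    then have "1 - x * r \<in> p" using \<open>u \<in> p\<close> by simp
    then show "\<exists>y. 1 - x * y \<in> p" by blast
  next
    fix p assume p: "p \<in> S"
    have "w0 ^ K p dvd w" unfolding w_def using finS p by (rule dvd_prodI)
    then show "w \<in> Q p" using ideal_dvd[OF Q(2)[OF p]] Q(3)[OF p S(2)[OF p]] by blast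
  next
    fix p q assume pq: "(p, q) \<in> Fam" "p \<notin> S"
    then have p: "primeideal p type_ring" "w0 \<notin> p" by (auto simp: Fam_def S_def)
    have "w \<notin> p" unfolding w_def by (intro primeideal_prod[OF p(1)] primeideal_power[OF p])
    then show "w \<notin> p \<and> (\<exists>A. card A = Suc N \<and> separated_mod p A)" using w0(2)[OF p] by blast
  qed (use Q in \<open>auto simp: Fam_def\<close>)
  moreover have "detects_nonunits Fam"
    unfolding detects_nonunits_def
  proof (intro conjI allI impI)
    show "\<forall>(p, q) \<in> Fam. primary_to p q" by (auto simp: Fam_def)
    fix A :: "'a set" and c :: 'a
    assume A: "\<not> (\<exists>I\<in>Nonunit. A \<subseteq> I)" and c: "c \<noteq> 0" "\<not> c dvd 1"
    define I where "I = {x. c dvd x}"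
    have I: "ideal I type_ring" "c \<in> I" unfolding I_def using ideal_multiples by auto
    have "I \<in> Nonunit" unfolding Nonunit_iff I_def using c by blast
    with A obtain x where x: "x \<in> A" "x \<notin> I" by blast
    have "noetherian_ring (type_ring :: 'a ring)" using assms(1) by (simp add: dedekind_domain_def)
    from noetherian_primary_avoiding[OF this I(1) x(2)]
    obtain p q where pq: "primeideal p type_ring" "primary_to p q" "I \<subseteq> q" "q \<subseteq> p" "x \<notin> q"
      by blast
    have "c \<in> q" using pq(3) I(2) by blast
    moreover have "(p, q) \<in> Fam" unfolding Fam_def using pq c(1) \<open>c \<in> q\<close> by auto
    ultimately show "\<exists>(p, q) \<in> Fam. c \<in> q \<and> \<not> A \<subseteq> q" using x(1) pq(5) by blast
  qed
  ultimately show ?thesis using w by blast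
qed

theorem exists_adjustment:
  fixes P :: "'a::idom poly"
  assumes "near_ufd TYPE('a) \<or> dedekind_domain TYPE('a)"
    and "\<not> (\<exists>I\<in>Nonunit. range (poly P) \<subseteq> I)"
  shows "\<exists>Fam t w. detects_nonunits Fam \<and> w \<noteq> 0 \<and> (\<forall>(p, q) \<in> Fam. adjusted_at (Suc N) P t w p q)"
proof (cases "\<exists>c::'a. c \<noteq> 0 \<and> \<not> c dvd 1")
  case True
  then obtain c :: 'a where c: "c \<noteq> 0" "\<not> c dvd 1" by blast
  then have inf: "infinite (UNIV :: 'a set)" by (rule infinite_if_nonunit)
  have "{x. c dvd x} \<in> Nonunit" unfolding Nonunit_iff using c by blast
  then have "\<not> range (poly P) \<subseteq> {x. c dvd x}" using assms(2) by blast
  then have "\<not> range (poly P) \<subseteq> {0}" by auto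
  then show ?thesis
    using assms near_ufd_adjust[OF _ inf] dedekind_adjust[OF _ inf] by metis
next
  case False
  \<comment> \<open>A field has no nonzero nonunits, so the empty family detects them and nothing
    has to be adjusted.\<close>
  then have "detects_nonunits ({} :: ('a set \<times> 'a set) set)" by (auto simp: detects_nonunits_def)
  then show ?thesis by (intro exI[of _ "{}"]) (auto intro: exI[of _ 1])
qed

section \<open>Homomorphisms of multivariate polynomials\<close>

lemma lookup_map: "h 0 = 0 \<Longrightarrow> Poly_Mapping.lookup (Poly_Mapping.map h p) m = h (Poly_Mapping.lookup p m)"
  by (auto simp: Poly_Mapping.map.rep_eq when_def)

lemma poly_mapping_sum_singles:
  "p = (\<Sum>m\<in>Poly_Mapping.keys p. Poly_Mapping.single m (Poly_Mapping.lookup p m))"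
  by (rule poly_mapping_eqI)
    (auto simp: lookup_sum lookup_single when_def sum.delta' not_in_keys_iff_lookup_eq_zero)

lemma mpoly_times_sum:
  fixes p q :: "'a::comm_ring_1 mpoly"
  shows "p * q = (\<Sum>a\<in>Poly_Mapping.keys p. \<Sum>b\<in>Poly_Mapping.keys q.
    Poly_Mapping.single (a + b) (Poly_Mapping.lookup p a * Poly_Mapping.lookup q b))"
  by (subst (1) poly_mapping_sum_singles[of p], subst (1) poly_mapping_sum_singles[of q])
    (simp add: sum_product mult_single)

text \<open>The common form of evaluation, of coefficientwise maps and of \<open>translate\<close>;
  multiplicativity is proved once, for multiplicative \<open>\<mu>\<close>.\<close>

definition mpoly_hom :: "('a::comm_ring_1 \<Rightarrow> 'b::comm_ring_1) \<Rightarrow> ((nat \<Rightarrow>\<^sub>0 nat) \<Rightarrow> 'b) \<Rightarrow> 'a mpoly \<Rightarrow> 'b"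
  where "mpoly_hom h \<mu> p = (\<Sum>m\<in>Poly_Mapping.keys p. h (Poly_Mapping.lookup p m) * \<mu> m)"

lemma mpoly_hom_superset:
  assumes "type_hom h" "finite K" "Poly_Mapping.keys p \<subseteq> K"
  shows "mpoly_hom h \<mu> p = (\<Sum>m\<in>K. h (Poly_Mapping.lookup p m) * \<mu> m)"
  unfolding mpoly_hom_def using assms
  by (intro sum.mono_neutral_left) (auto simp: in_keys_iff type_hom_zero)

lemma mpoly_hom_single: "type_hom h \<Longrightarrow> mpoly_hom h \<mu> (Poly_Mapping.single m c) = h c * \<mu> m"
  by (subst mpoly_hom_superset[where K = "{m}"]) auto

lemma mpoly_hom_add:
  assumes "type_hom h"
  shows "mpoly_hom h \<mu> (p + q) = mpoly_hom h \<mu> p + mpoly_hom h \<mu> q"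
proof -
  let ?K = "Poly_Mapping.keys p \<union> Poly_Mapping.keys q"
  have "Poly_Mapping.keys (p + q) \<subseteq> ?K" by (rule Poly_Mapping.keys_add)
  then show ?thesis
    by (simp add: mpoly_hom_superset[OF assms, of ?K] lookup_add type_hom_add[OF assms]
        distrib_right sum.distrib)
qed

lemma mpoly_hom_sum:
  assumes "type_hom h"
  shows "mpoly_hom h \<mu> (sum f A) = (\<Sum>x\<in>A. mpoly_hom h \<mu> (f x))"
  by (induction A rule: infinite_finite_induct) (auto simp: mpoly_hom_add[OF assms], auto simp: mpoly_hom_def)

lemma type_hom_mpoly_hom:
  assumes h: "type_hom h" and \<mu>: "\<mu> 0 = 1" "\<And>a b. \<mu> (a + b) = \<mu> a * \<mu> b"
  shows "type_hom (mpoly_hom h \<mu>)"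
  unfolding type_hom_def
proof (intro conjI allI)
  show "mpoly_hom h \<mu> 1 = 1"
    unfolding single_one[symmetric] mpoly_hom_single[OF h] using \<mu>(1) type_hom_one[OF h] by simp
  show "mpoly_hom h \<mu> (p + q) = mpoly_hom h \<mu> p + mpoly_hom h \<mu> q" for p q
    by (rule mpoly_hom_add[OF h])
  show "mpoly_hom h \<mu> (p * q) = mpoly_hom h \<mu> p * mpoly_hom h \<mu> q" for p q
    unfolding mpoly_times_sum[of p q] mpoly_hom_sum[OF h] mpoly_hom_single[OF h]
    by (simp add: mpoly_hom_def sum_product type_hom_mult[OF h] \<mu>(2) ac_simps)
qed

lemma mpoly_const_single: "Poly_Mapping.single m (c :: 'a::comm_ring_1) = mpoly_const c * Poly_Mapping.single m 1"
  by (simp add: mpoly_const_def mult_single)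

lemma mpoly_hom_eqI:
  assumes "type_hom g" "type_hom g'" "\<And>c. g (mpoly_const c) = g' (mpoly_const c)"
    and "\<And>m. g (Poly_Mapping.single m 1) = g' (Poly_Mapping.single m 1)"
  shows "g p = g' p"
proof -
  have "g (Poly_Mapping.single m c) = g' (Poly_Mapping.single m c)" for m c
    unfolding mpoly_const_single[of m c] by (simp only: assms(3,4) type_hom_mult[OF assms(1)] type_hom_mult[OF assms(2)])
  then show ?thesis
    by (subst (1 2) poly_mapping_sum_singles[of p])
      (simp only: type_hom_sum[OF assms(1)] type_hom_sum[OF assms(2)])
qed

lemma type_hom_mpoly_const: "type_hom (mpoly_const :: 'a::comm_ring_1 \<Rightarrow> _)"
  by (auto simp: type_hom_def mpoly_const_def single_add mult_single)

lemma mpoly_const_0 [simp]: "mpoly_const 0 = 0"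
  and mpoly_const_1 [simp]: "mpoly_const (1 :: 'a::comm_ring_1) = 1"
  by (simp_all add: mpoly_const_def)

lemma mpoly_const_eq_0_iff [simp]: "mpoly_const c = 0 \<longleftrightarrow> c = 0"
  unfolding mpoly_const_def by (metis lookup_single_eq lookup_zero single_zero)

lemma mpoly_const_inject [simp]: "mpoly_const c = mpoly_const c' \<longleftrightarrow> c = c'"
  unfolding mpoly_const_def by (metis lookup_single_eq)

lemma lookup_mpoly_const: "Poly_Mapping.lookup (mpoly_const c) m = (if m = 0 then c else 0)"
  by (auto simp: mpoly_const_def lookup_single when_def)

lemma type_hom_mpoly_eval: "type_hom (mpoly_eval (t :: nat \<Rightarrow> 'a::comm_ring_1))"
proof -
  let ?\<mu> = "\<lambda>m. \<Prod>i\<in>Poly_Mapping.keys m. t i ^ Poly_Mapping.lookup m i"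
  have \<mu>: "?\<mu> m = (\<Prod>i\<in>K. t i ^ Poly_Mapping.lookup m i)" if "finite K" "Poly_Mapping.keys m \<subseteq> K" for m K
    using that by (intro prod.mono_neutral_left) (auto simp: in_keys_iff)
  have "?\<mu> (a + b) = ?\<mu> a * ?\<mu> b" for a b
  proof -
    let ?K = "Poly_Mapping.keys a \<union> Poly_Mapping.keys b"
    have "?\<mu> (a + b) = (\<Prod>i\<in>?K. t i ^ Poly_Mapping.lookup (a + b) i)"
      by (rule \<mu>) (auto dest: set_mp[OF Poly_Mapping.keys_add])
    also have "\<dots> = (\<Prod>i\<in>?K. t i ^ Poly_Mapping.lookup a i) * (\<Prod>i\<in>?K. t i ^ Poly_Mapping.lookup b i)"
      by (simp add: lookup_add power_add prod.distrib)
    also have "\<dots> = ?\<mu> a * ?\<mu> b"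
      by (intro arg_cong2[where f = "(*)"] \<mu>[symmetric]) auto
    finally show ?thesis .
  qed
  then have "type_hom (mpoly_hom (\<lambda>x. x) ?\<mu>)"
    by (intro type_hom_mpoly_hom type_hom_id) auto
  moreover have "mpoly_eval t = mpoly_hom (\<lambda>x. x) ?\<mu>"
    by (auto simp: mpoly_eval_def mpoly_hom_def)
  ultimately show ?thesis by simp
qed

lemma mpoly_eval_single:
  "mpoly_eval t (Poly_Mapping.single m c) = c * (\<Prod>i\<in>Poly_Mapping.keys m. t i ^ Poly_Mapping.lookup m i)"
  by (auto simp: mpoly_eval_def)

lemma mpoly_eval_const [simp]: "mpoly_eval t (mpoly_const c) = c"
  by (simp add: mpoly_const_def mpoly_eval_single)

lemma type_hom_map:
  assumes "type_hom h"
  shows "type_hom (Poly_Mapping.map h :: 'a::comm_ring_1 mpoly \<Rightarrow> 'b::comm_ring_1 mpoly)"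
proof -
  have c: "type_hom (\<lambda>c. mpoly_const (h c))"
    by (rule type_hom_comp[OF type_hom_mpoly_const assms])
  have "type_hom (mpoly_hom (\<lambda>c. mpoly_const (h c)) (\<lambda>m. Poly_Mapping.single m 1))"
    by (rule type_hom_mpoly_hom[OF c]) (auto simp: mult_single)
  moreover have "Poly_Mapping.map h p = mpoly_hom (\<lambda>c. mpoly_const (h c)) (\<lambda>m. Poly_Mapping.single m 1) p" for p
    by (rule poly_mapping_eqI)
      (auto simp: mpoly_hom_def mpoly_const_single[symmetric] lookup_sum lookup_single when_def
        lookup_map type_hom_zero[OF assms] sum.delta' not_in_keys_iff_lookup_eq_zero)
  ultimately show ?thesis by presburger
qed

lemma map_mpoly_const: "type_hom h \<Longrightarrow> Poly_Mapping.map h (mpoly_const c) = mpoly_const (h c)"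
  by (simp add: mpoly_const_def type_hom_zero)

section \<open>Leading coefficients\<close>

lemma lookup_mpoly_times:
  fixes p q :: "'a::comm_ring_1 mpoly"
  shows "Poly_Mapping.lookup (p * q) m =
    (\<Sum>(a, b)\<in>Poly_Mapping.keys p \<times> Poly_Mapping.keys q.
      if a + b = m then Poly_Mapping.lookup p a * Poly_Mapping.lookup q b else 0)"
  by (subst mpoly_times_sum)
    (auto simp: lookup_sum lookup_single when_def sum.cartesian_product intro!: sum.cong)

text \<open>Exponents are linearly ordered compatibly with addition. If x + y = a + b but (x, y)
  differs from (a, b), then x > a or y > b, so every other contribution to this coefficient lies in
  \<open>p\<close>. The zero ideal gives ordinary leading terms, a general prime gives Gauss'
  lemma.\<close>

lemma leading_coefficient_mult:
  fixes f g :: "'a::comm_ring_1 mpoly"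
  assumes p: "primeideal p (type_ring :: 'a ring)"
    and f: "Poly_Mapping.lookup f a \<notin> p" "\<And>m. m > a \<Longrightarrow> Poly_Mapping.lookup f m \<in> p"
    and g: "Poly_Mapping.lookup g b \<notin> p" "\<And>m. m > b \<Longrightarrow> Poly_Mapping.lookup g m \<in> p"
  shows "Poly_Mapping.lookup (f * g) (a + b) \<notin> p"
proof
  have id: "ideal p type_ring" using p by (simp add: primeideal_type_ring_iff)
  assume *: "Poly_Mapping.lookup (f * g) (a + b) \<in> p"
  let ?K = "Poly_Mapping.keys f \<times> Poly_Mapping.keys g"
  let ?t = "\<lambda>(x, y). if x + y = a + b then Poly_Mapping.lookup f x * Poly_Mapping.lookup g y else 0"
  have in_keys: "a \<in> Poly_Mapping.keys f" "b \<in> Poly_Mapping.keys g"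
    using f(1) g(1) ideal_zero[OF id] by (auto simp: in_keys_iff)
  have "Poly_Mapping.lookup (f * g) (a + b) = sum ?t ?K" by (rule lookup_mpoly_times)
  also have "\<dots> = ?t (a, b) + sum ?t (?K - {(a, b)})"
    using in_keys by (intro sum.remove) auto
  finally have eq: "Poly_Mapping.lookup f a * Poly_Mapping.lookup g b =
      Poly_Mapping.lookup (f * g) (a + b) - sum ?t (?K - {(a, b)})" by simp
  have "sum ?t (?K - {(a, b)}) \<in> p"
  proof (rule ideal_sum[OF id])
    fix z assume z: "z \<in> ?K - {(a, b)}"
    obtain x y where xy: "z = (x, y)" by (cases z)
    show "?t z \<in> p"
    proof (cases "x + y = a + b")
      case True
      have "x > a \<or> y > b"
      proof (rule ccontr)
        assume "\<not> ?thesis"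
        then have le: "x \<le> a" "y \<le> b" by auto
        then have "x = a"
          using True add_less_le_mono[of x a y b] by (metis less_irrefl order.not_eq_order_implies_strict)
        then show False using True z xy by simp
      qed
      then show ?thesis
        using f(2) g(2) ideal_mult_left[OF id] ideal_mult_right[OF id] True by (auto simp: xy)
    qed (simp add: xy ideal_zero[OF id])
  qed
  then have "Poly_Mapping.lookup f a * Poly_Mapping.lookup g b \<in> p"
    unfolding eq by (rule ideal_diff[OF id *])
  then show False using f(1) g(1) p by (auto simp: primeideal_type_ring_iff)
qed

lemma exists_leading_coefficient:
  fixes f :: "'a::comm_ring_1 mpoly"
  assumes "ideal p (type_ring :: 'a ring)" "Poly_Mapping.lookup f m \<notin> p"
  obtains a where "Poly_Mapping.lookup f a \<notin> p" "\<And>m. m > a \<Longrightarrow> Poly_Mapping.lookup f m \<in> p"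
proof -
  let ?K = "{m \<in> Poly_Mapping.keys f. Poly_Mapping.lookup f m \<notin> p}"
  have "m \<in> ?K" using assms ideal_zero[OF assms(1)] by (auto simp: in_keys_iff)
  then have "Max ?K \<in> ?K" by (intro Max_in) auto
  moreover have "Poly_Mapping.lookup f m \<in> p" if "m > Max ?K" for m
  proof (rule ccontr)
    assume "Poly_Mapping.lookup f m \<notin> p"
    then have "m \<in> ?K" using ideal_zero[OF assms(1)] by (auto simp: in_keys_iff)
    then have "m \<le> Max ?K" by (intro Max_ge) auto
    then show False using that by simp
  qed
  ultimately show ?thesis using that by blast
qed

lemma gauss_mpoly:
  fixes f g :: "'a::comm_ring_1 mpoly"
  assumes "primeideal p (type_ring :: 'a ring)" "\<And>m. Poly_Mapping.lookup (f * g) m \<in> p"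
  shows "(\<forall>m. Poly_Mapping.lookup f m \<in> p) \<or> (\<forall>m. Poly_Mapping.lookup g m \<in> p)"
proof (rule ccontr)
  have id: "ideal p type_ring" using assms(1) by (simp add: primeideal_type_ring_iff)
  assume "\<not> ?thesis"
  then obtain m m' where "Poly_Mapping.lookup f m \<notin> p" "Poly_Mapping.lookup g m' \<notin> p" by blast
  then show False
    using leading_coefficient_mult[OF assms(1)] assms(2) exists_leading_coefficient[OF id] by metis
qed

lemma zero_le_exponent: "(0 :: nat \<Rightarrow>\<^sub>0 nat) \<le> m"
proof (cases "m = 0")
  case False
  then have ex: "\<exists>k. Poly_Mapping.lookup m k \<noteq> 0" by (metis poly_mapping_eqI lookup_zero)
  define k where "k = (LEAST k. Poly_Mapping.lookup m k \<noteq> 0)"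
  have "Poly_Mapping.lookup m k \<noteq> 0" unfolding k_def by (rule LeastI_ex[OF ex])
  moreover have "Poly_Mapping.lookup m i = 0" if "i < k" for i
    using not_less_Least[OF that[unfolded k_def]] by simp
  ultimately show ?thesis
    by (auto simp: less_eq_poly_mapping.rep_eq less_fun_def intro!: exI[of _ k])
qed simp

text \<open>The leading exponents of the factors add up to 0, so both vanish; 0 is the least
  exponent, hence nothing but the constant term remains.\<close>

lemma factor_of_const:
  fixes f g :: "'a::idom mpoly"
  assumes "f * g = mpoly_const c" "c \<noteq> 0"
  shows "f = mpoly_const (Poly_Mapping.lookup f 0)"
proof -
  have p: "primeideal {0} (type_ring :: 'a ring)"
    by (auto simp: primeideal_type_ring_iff ideal_type_ring_iff)
  then have id: "ideal {0} (type_ring :: 'a ring)" by (simp add: primeideal_type_ring_iff)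
  have "f \<noteq> 0" "g \<noteq> 0"
    using assms by (metis lookup_mpoly_const lookup_zero mult_zero_left,
        metis lookup_mpoly_const lookup_zero mult_zero_right)
  then obtain m m' where "Poly_Mapping.lookup f m \<notin> {0}" "Poly_Mapping.lookup g m' \<notin> {0}"
    by (metis poly_mapping_eqI lookup_zero singletonD)
  then obtain a b where
    a: "Poly_Mapping.lookup f a \<notin> {0}" "\<And>m. m > a \<Longrightarrow> Poly_Mapping.lookup f m \<in> {0}" and
    b: "Poly_Mapping.lookup g b \<notin> {0}" "\<And>m. m > b \<Longrightarrow> Poly_Mapping.lookup g m \<in> {0}"
    using exists_leading_coefficient[OF id] by metis
  from leading_coefficient_mult[OF p a b] have "a + b = 0"
    by (auto simp: assms(1) lookup_mpoly_const split: if_splits)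
  then have "Poly_Mapping.lookup a i = 0" for i
    by (metis add_is_0 lookup_add lookup_zero)
  then have "a = 0" by (intro poly_mapping_eqI) simp
  then have "Poly_Mapping.lookup f m = 0" if "m \<noteq> 0" for m
    using a(2)[of m] that zero_le_exponent[of m] by auto
  then show ?thesis by (intro poly_mapping_eqI) (auto simp: lookup_mpoly_const)
qed

section \<open>Substituting a translated monomial\<close>

text \<open>The polynomial p(a + Y^d), over an arbitrary coefficient ring: a = T gives the family to
  which the Hilbert property is applied, a = m its specialization, and a = 0 with a single variable
  embeds univariate polynomials.\<close>

definition shift_subst :: "'a::comm_ring_1 \<Rightarrow> (nat \<Rightarrow>\<^sub>0 nat) \<Rightarrow> 'a poly \<Rightarrow> 'a mpoly"
  where "shift_subst a d p = poly (map_poly mpoly_const p) (mpoly_const a + Poly_Mapping.single d 1)"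

definition exponent_scale :: "nat \<Rightarrow> (nat \<Rightarrow>\<^sub>0 nat) \<Rightarrow> (nat \<Rightarrow>\<^sub>0 nat)"
  where "exponent_scale j d = Poly_Mapping.map ((*) j) d"

lemma lookup_exponent_scale [simp]:
  "Poly_Mapping.lookup (exponent_scale j d) i = j * Poly_Mapping.lookup d i"
  by (simp add: exponent_scale_def lookup_map)

lemma exponent_scale_inject:
  assumes "d \<noteq> 0"
  shows "exponent_scale i d = exponent_scale j d \<longleftrightarrow> i = j"
proof -
  obtain k where "Poly_Mapping.lookup d k \<noteq> 0" using assms by (metis poly_mapping_eqI lookup_zero)
  then show ?thesis by (metis lookup_exponent_scale mult_right_cancel)
qed

lemma single_power: "Poly_Mapping.single d (1 :: 'a::comm_ring_1) ^ j = Poly_Mapping.single (exponent_scale j d) 1"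
proof (induction j)
  case 0
  have "exponent_scale 0 d = 0" by (rule poly_mapping_eqI) simp
  then show ?case by (simp only: power_0 single_one)
next
  case (Suc j)
  have "d + exponent_scale j d = exponent_scale (Suc j) d"
    by (rule poly_mapping_eqI) (simp add: lookup_add)
  then show ?case by (simp add: Suc mult_single)
qed

lemma shift_subst_altdef:
  "shift_subst a d p = poly (map_poly mpoly_const (pcompose p [:a, 1:])) (Poly_Mapping.single d 1)"
proof -
  have "map_poly mpoly_const [:a, 1:] = [:mpoly_const a, 1:]"
    by (simp add: map_poly_pCons type_hom_zero[OF type_hom_mpoly_const] type_hom_one[OF type_hom_mpoly_const])
  then show ?thesis
    by (simp add: shift_subst_def map_poly_pcompose[OF type_hom_mpoly_const] poly_pcompose add.commute)
qed

lemma shift_subst_sum: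
  "shift_subst a d p = (\<Sum>j\<le>Polynomial.degree p.
    Poly_Mapping.single (exponent_scale j d) (Polynomial.coeff (pcompose p [:a, 1:]) j))"
proof -
  let ?q = "pcompose p [:a, 1:]"
  have "Polynomial.degree ?q \<le> Polynomial.degree p * 1"
    by (rule order.trans[OF degree_pcompose_le]) simp
  then have "Polynomial.degree (map_poly mpoly_const ?q) \<le> Polynomial.degree p"
    using map_poly_degree_leq[of mpoly_const ?q] by simp
  then have "shift_subst a d p = (\<Sum>j\<le>Polynomial.degree p.
      Polynomial.coeff (map_poly mpoly_const ?q) j * Poly_Mapping.single d 1 ^ j)"
    unfolding shift_subst_altdef poly_altdef by (intro sum.mono_neutral_left) (auto simp: coeff_eq_0)
  then show ?thesis
    by (simp add: coeff_map_poly type_hom_zero[OF type_hom_mpoly_const] single_power mpoly_const_single[symmetric])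
qed

text \<open>For nonzero d the multiples of d are distinct, so the coefficients of p(a + Y^d) are
  exactly those of p(a + X). This reduces content questions in several variables to one
  variable.\<close>

lemma lookup_shift_subst:
  assumes "d \<noteq> 0"
  shows "Poly_Mapping.lookup (shift_subst a d p) (exponent_scale j d) = Polynomial.coeff (pcompose p [:a, 1:]) j"
proof -
  have "Polynomial.degree (pcompose p [:a, 1:]) \<le> Polynomial.degree p * 1"
    by (rule order.trans[OF degree_pcompose_le]) simp
  then have "Polynomial.coeff (pcompose p [:a, 1:]) j = 0" if "j > Polynomial.degree p"
    using that by (intro coeff_eq_0) simp
  then show ?thesis
    by (auto simp: shift_subst_sum lookup_sum lookup_single when_def exponent_scale_inject[OF assms] sum.delta)
qed

lemma lookup_shift_subst_other:
  assumes "\<And>j. m \<noteq> exponent_scale j d"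
  shows "Poly_Mapping.lookup (shift_subst a d p) m = 0"
  using assms[symmetric] by (auto simp: shift_subst_sum lookup_sum lookup_single when_def)

lemma lookup_shift_subst_0:
  assumes "d \<noteq> 0"
  shows "Poly_Mapping.lookup (shift_subst a d p) 0 = poly p a"
proof -
  have "exponent_scale 0 d = 0" by (rule poly_mapping_eqI) simp
  then have "Poly_Mapping.lookup (shift_subst a d p) 0 = Polynomial.coeff (pcompose p [:a, 1:]) 0"
    using lookup_shift_subst[OF assms, of a p 0] by simp
  then show ?thesis by (simp add: poly_0_coeff_0[symmetric] poly_pcompose)
qed

lemma map_shift_subst:
  assumes "type_hom h"
  shows "Poly_Mapping.map h (shift_subst a d p) = shift_subst (h a) d (map_poly h p)"
proof -
  note map_hom = type_hom_map[OF assms]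
  have "map_poly (Poly_Mapping.map h) (map_poly mpoly_const p) = map_poly mpoly_const (map_poly h p)"
    by (rule poly_eqI)
      (simp add: coeff_map_poly type_hom_zero[OF type_hom_mpoly_const] type_hom_zero[OF assms]
        type_hom_zero[OF map_hom] map_mpoly_const[OF assms])
  moreover have "Poly_Mapping.map h (Poly_Mapping.single d 1) = Poly_Mapping.single d 1"
    by (rule poly_mapping_eqI)
      (simp add: lookup_map type_hom_zero[OF assms] type_hom_one[OF assms] lookup_single when_def)
  ultimately show ?thesis
    unfolding shift_subst_def type_hom_poly[OF map_hom] type_hom_add[OF map_hom] map_mpoly_const[OF assms]
    by (simp only:)
qed

lemma type_hom_shift_subst: "type_hom (shift_subst a d)"
  unfolding shift_subst_def
  by (rule type_hom_comp[OF type_hom_eval_poly type_hom_map_poly[OF type_hom_mpoly_const]])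

section \<open>Rings of polynomials in finitely many variables\<close>

lemma mpoly_ring_simps [simp]:
  "x \<otimes>\<^bsub>mpoly_ring n S\<^esub> y = x * y" "\<one>\<^bsub>mpoly_ring n S\<^esub> = 1" "\<zero>\<^bsub>mpoly_ring n S\<^esub> = 0"
  by (simp_all add: mpoly_ring_def)

lemma carrier_mpoly_ring_iff:
  "p \<in> carrier (mpoly_ring n S) \<longleftrightarrow>
    (\<forall>m\<in>Poly_Mapping.keys p. Poly_Mapping.keys m \<subseteq> {..<n}) \<and> (\<forall>m. Poly_Mapping.lookup p m \<in> S)"
  by (simp add: mpoly_ring_def)

definition type_subring :: "'a::comm_ring_1 set \<Rightarrow> bool"
  where "type_subring S \<longleftrightarrow>
    0 \<in> S \<and> 1 \<in> S \<and> (\<forall>x\<in>S. \<forall>y\<in>S. x + y \<in> S) \<and> (\<forall>x\<in>S. \<forall>y\<in>S. x * y \<in> S)"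

lemma type_subring_UNIV [simp]: "type_subring UNIV"
  by (simp add: type_subring_def)

lemma type_subring_sum:
  assumes "type_subring S" "\<And>x. x \<in> A \<Longrightarrow> f x \<in> S"
  shows "sum f A \<in> S"
  using assms(2) by (induction A rule: infinite_finite_induct)
    (use assms(1) in \<open>auto simp: type_subring_def\<close>)

lemma type_subring_poly:
  assumes "type_subring S" "\<And>i. Polynomial.coeff p i \<in> S" "x \<in> S"
  shows "poly p x \<in> S"
  using assms(2)
proof (induction p)
  case (pCons a p)
  have "a \<in> S" using pCons.prems[of 0] by simp
  moreover have "Polynomial.coeff p i \<in> S" for i using pCons.prems[of "Suc i"] by simp
  then have "poly p x \<in> S" by (rule pCons.IH)
  ultimately show ?case using assms(1,3) by (simp add: type_subring_def)
qed (use assms(1) in \<open>auto simp: type_subring_def\<close>)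

lemma type_subring_mpoly_ring:
  assumes S: "type_subring S"
  shows "type_subring (carrier (mpoly_ring n S))"
  unfolding type_subring_def
proof (intro conjI ballI)
  show "0 \<in> carrier (mpoly_ring n S)" "1 \<in> carrier (mpoly_ring n S)"
    using S by (auto simp: carrier_mpoly_ring_iff type_subring_def lookup_one when_def)
  fix p q assume p: "p \<in> carrier (mpoly_ring n S)" and q: "q \<in> carrier (mpoly_ring n S)"
  have "Poly_Mapping.keys m \<subseteq> {..<n}" if "m \<in> Poly_Mapping.keys (p + q)" for m
    using p q set_mp[OF Poly_Mapping.keys_add that] by (auto simp: carrier_mpoly_ring_iff)
  then show "p + q \<in> carrier (mpoly_ring n S)"
    using p q S by (auto simp: carrier_mpoly_ring_iff type_subring_def lookup_add)
  have "Poly_Mapping.keys m \<subseteq> {..<n}" if m: "m \<in> Poly_Mapping.keys (p * q)" for m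
  proof -
    obtain a b where ab: "m = a + b" "a \<in> Poly_Mapping.keys p" "b \<in> Poly_Mapping.keys q"
      using keys_mult[of p q] m by blast
    have "Poly_Mapping.keys m \<subseteq> Poly_Mapping.keys a \<union> Poly_Mapping.keys b"
      unfolding ab(1) by (rule Poly_Mapping.keys_add)
    moreover have "Poly_Mapping.keys a \<subseteq> {..<n}" "Poly_Mapping.keys b \<subseteq> {..<n}"
      using p q ab by (auto simp only: carrier_mpoly_ring_iff)
    ultimately show ?thesis by blast
  qed
  moreover have "Poly_Mapping.lookup (p * q) m \<in> S" for m
    unfolding lookup_mpoly_times
    by (rule type_subring_sum[OF S]) (use p q S in \<open>auto simp: carrier_mpoly_ring_iff type_subring_def\<close>)
  ultimately show "p * q \<in> carrier (mpoly_ring n S)" by (auto simp: carrier_mpoly_ring_iff)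
qed

lemma mpoly_const_carrier: "0 \<in> S \<Longrightarrow> c \<in> S \<Longrightarrow> mpoly_const c \<in> carrier (mpoly_ring n S)"
  by (auto simp: carrier_mpoly_ring_iff mpoly_const_def lookup_single when_def split: if_splits)

lemma single_carrier:
  "0 \<in> S \<Longrightarrow> c \<in> S \<Longrightarrow> Poly_Mapping.keys m \<subseteq> {..<n} \<Longrightarrow>
    Poly_Mapping.single m c \<in> carrier (mpoly_ring n S)"
  by (auto simp: carrier_mpoly_ring_iff lookup_single when_def split: if_splits)

lemma shift_subst_carrier:
  assumes S: "type_subring S" and "a \<in> S" "\<And>i. Polynomial.coeff p i \<in> S" "Poly_Mapping.keys d \<subseteq> {..<n}"
  shows "shift_subst a d p \<in> carrier (mpoly_ring n S)"
proof -
  have 01: "0 \<in> S" "1 \<in> S" using S by (auto simp: type_subring_def)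
  have "mpoly_const a + Poly_Mapping.single d 1 \<in> carrier (mpoly_ring n S)"
    using type_subring_mpoly_ring[OF S, of n] mpoly_const_carrier[OF 01(1) assms(2)]
      single_carrier[OF 01 assms(4)] unfolding type_subring_def by blast
  then show ?thesis
    unfolding shift_subst_def
    by (intro type_subring_poly type_subring_mpoly_ring S)
      (auto simp: coeff_map_poly type_hom_zero[OF type_hom_mpoly_const] mpoly_const_carrier[OF 01(1) assms(3)])
qed

lemma Units_mpoly_ring_iff:
  "x \<in> Units (mpoly_ring n S) \<longleftrightarrow>
    x \<in> carrier (mpoly_ring n S) \<and> (\<exists>y\<in>carrier (mpoly_ring n S). x * y = 1)"
  by (auto simp: Units_def mult.commute)

lemma mpoly_ring_irreducibleI:
  assumes "a \<noteq> 0" "a \<notin> Units (mpoly_ring n S)"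
    and "\<And>b c. b \<in> carrier (mpoly_ring n S) \<Longrightarrow> c \<in> carrier (mpoly_ring n S) \<Longrightarrow> a = b * c \<Longrightarrow>
      b \<in> Units (mpoly_ring n S) \<or> c \<in> Units (mpoly_ring n S)"
  shows "ring_irreducible\<^bsub>mpoly_ring n S\<^esub> a"
proof -
  have "b \<in> Units (mpoly_ring n S)"
    if b: "b \<in> carrier (mpoly_ring n S)" and pf: "properfactor (mpoly_ring n S) b a" for b
  proof -
    obtain c where c: "c \<in> carrier (mpoly_ring n S)" "a = b * c"
      using pf by (auto simp: properfactor_def factor_def)
    have "c \<notin> Units (mpoly_ring n S)"
    proof
      assume "c \<in> Units (mpoly_ring n S)"
      then obtain y where y: "y \<in> carrier (mpoly_ring n S)" "c * y = 1"
        by (auto simp: Units_mpoly_ring_iff)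
      have "a * y = b * (c * y)" by (simp only: c(2) mult.assoc)
      then have "b = a * y" using y(2) by simp
      then have "a divides\<^bsub>mpoly_ring n S\<^esub> b" using y(1) by (auto simp: factor_def)
      then show False using pf by (simp add: properfactor_def)
    qed
    with assms(3)[OF b c] show ?thesis by blast
  qed
  then show ?thesis
    using assms(1,2) by (auto simp: ring_irreducible_def Divisibility.irreducible_def)
qed

lemma mpoly_ring_irreducibleD:
  fixes a :: "'a::idom mpoly"
  assumes "ring_irreducible\<^bsub>mpoly_ring n S\<^esub> a"
    and "b \<in> carrier (mpoly_ring n S)" "c \<in> carrier (mpoly_ring n S)" "a = b * c"
  shows "b \<in> Units (mpoly_ring n S) \<or> c \<in> Units (mpoly_ring n S)"
proof (cases "a divides\<^bsub>mpoly_ring n S\<^esub> b")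
  case True
  then obtain y where y: "y \<in> carrier (mpoly_ring n S)" "b = a * y" by (auto simp: factor_def)
  have "a \<noteq> 0" using assms(1) by (simp add: ring_irreducible_def)
  moreover have "a * (c * y) = (a * y) * c" by (simp add: ac_simps)
  then have "a * (c * y) = a * 1" by (simp only: y(2)[symmetric] assms(4)[symmetric] mult_1_right)
  ultimately have "c * y = 1" using mult_left_cancel by blast
  then show ?thesis using y(1) assms(3) by (auto simp: Units_mpoly_ring_iff)
next
  case False
  have "b divides\<^bsub>mpoly_ring n S\<^esub> a" using assms(3,4) by (auto simp: factor_def)
  with False have "properfactor (mpoly_ring n S) b a" by (simp add: properfactor_def)
  then show ?thesis
    using assms(1,2) by (simp add: ring_irreducible_def Divisibility.irreducible_def)
qed

section \<open>The automorphism \<open>T \<mapsto> T + Y\<^sup>d\<close>\<close>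

text \<open>The substitution T \<mapsto> T + u on K[T][Y] that fixes Y. As u may involve Y, it does
  not act coefficientwise. The parameter T is the variable of a univariate \<open>poly\<close>,
  where irreducible elements over a field are known to be prime.\<close>

definition translate :: "'b::comm_ring_1 poly mpoly \<Rightarrow> 'b poly mpoly \<Rightarrow> 'b poly mpoly"
  where "translate u = mpoly_hom
    (\<lambda>f. poly (map_poly (\<lambda>c. mpoly_const [:c:]) f) (mpoly_const [:0, 1:] + u))
    (\<lambda>m. Poly_Mapping.single m 1)"

lemma type_hom_const_const: "type_hom (\<lambda>c. mpoly_const [:c:])"
  by (rule type_hom_comp[OF type_hom_mpoly_const type_hom_const_poly])

lemma type_hom_translate_coeff:
  "type_hom (\<lambda>f. poly (map_poly (\<lambda>c. mpoly_const [:c:]) f) (mpoly_const [:0, 1:] + u))"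
  by (rule type_hom_comp[OF type_hom_eval_poly type_hom_map_poly[OF type_hom_const_const]])

lemma type_hom_translate: "type_hom (translate u)"
  unfolding translate_def by (rule type_hom_mpoly_hom[OF type_hom_translate_coeff]) (auto simp: mult_single)

lemma translate_const:
  "translate u (mpoly_const f) = poly (map_poly (\<lambda>c. mpoly_const [:c:]) f) (mpoly_const [:0, 1:] + u)"
  unfolding translate_def mpoly_const_def[of f] by (simp add: mpoly_hom_single[OF type_hom_translate_coeff])

lemma translate_single: "translate u (Poly_Mapping.single m 1) = Poly_Mapping.single m 1"
  unfolding translate_def
  by (simp add: mpoly_hom_single[OF type_hom_translate_coeff] type_hom_one[OF type_hom_translate_coeff])

lemma poly_const_const:
  "poly (map_poly (\<lambda>c. mpoly_const [:c:]) f) (mpoly_const [:0, 1:]) = mpoly_const (f :: 'b::comm_ring_1 poly)"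
proof (induction f)
  case (pCons a f)
  have "mpoly_const (pCons a f) = mpoly_const [:a:] + mpoly_const [:0, 1:] * mpoly_const f"
    unfolding type_hom_add[OF type_hom_mpoly_const, symmetric] type_hom_mult[OF type_hom_mpoly_const, symmetric]
    by simp
  then show ?case by (simp add: map_poly_pCons type_hom_zero[OF type_hom_const_const] pCons)
qed (simp add: type_hom_zero[OF type_hom_mpoly_const])

text \<open>The hypothesis holds when u is free of T. Then T goes to T + u and on to T - u + u,
  while Y is fixed, so the composite is the identity on generators.\<close>

lemma translate_translate:
  assumes "translate (- u) u = u"
  shows "translate (- u) (translate u p) = p"
proof (rule mpoly_hom_eqI[where g' = "\<lambda>x. x"])
  show "type_hom (\<lambda>p. translate (- u) (translate u p))"
    by (rule type_hom_comp[OF type_hom_translate type_hom_translate])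
  fix f
  have "map_poly (translate (- u)) (map_poly (\<lambda>c. mpoly_const [:c:]) f) = map_poly (\<lambda>c. mpoly_const [:c:]) f"
    by (rule poly_eqI)
      (simp add: coeff_map_poly type_hom_zero[OF type_hom_const_const] type_hom_zero[OF type_hom_translate]
        translate_const map_poly_pCons)
  moreover have "translate (- u) (mpoly_const [:0, 1:]) = mpoly_const [:0, 1:] + - u"
    by (simp add: translate_const map_poly_pCons type_hom_zero[OF type_hom_const_const]
        type_hom_one[OF type_hom_const_const])
  ultimately show "translate (- u) (translate u (mpoly_const f)) = mpoly_const f"
    by (simp add: translate_const[of u] type_hom_poly[OF type_hom_translate]
        type_hom_add[OF type_hom_translate] assms poly_const_const)
qed (auto simp: type_hom_id translate_single)

lemma lookup_const_mult:
  "Poly_Mapping.lookup (mpoly_const c * p) m = (c :: 'a::comm_ring_1) * Poly_Mapping.lookup p m"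
  unfolding mpoly_const_def mult_map_scale_conv_mult[symmetric] by (simp add: lookup_map)

text \<open>The factor b comes from clearing denominators. After T \<mapsto> T - Y^d the prime R
  divides the coefficients of one translated factor, by Gauss' lemma. Translating back, R(T + Y^d)
  divides that factor, so the other factor divides b and is free of Y.\<close>

lemma shift_subst_factor:
  fixes R :: "'b::field poly"
  assumes R: "Factorial_Ring.irreducible R" and b: "b \<noteq> 0"
    and AB: "A * B = mpoly_const b * shift_subst [:0, 1:] d (map_poly (\<lambda>c. [:c:]) R)"
  shows "(\<exists>\<beta>. A = mpoly_const \<beta>) \<or> (\<exists>\<beta>. B = mpoly_const \<beta>)"
proof -
  let ?u = "Poly_Mapping.single d 1 :: 'b poly mpoly"
  let ?\<sigma> = "translate ?u" and ?\<tau> = "translate (- ?u)"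
  define Pt where "Pt = shift_subst [:0, 1:] d (map_poly (\<lambda>c. [:c:]) R)"
  have fixed: "?\<tau> ?u = ?u" by (rule translate_single)
  have fixed': "translate (- (- ?u)) (- ?u) = - ?u"
    by (simp add: type_hom_uminus[OF type_hom_translate] translate_single)
  have \<sigma>\<tau>: "?\<sigma> (?\<tau> x) = x" for x
    using translate_translate[OF fixed', of x] by simp
  have Pt: "Pt = ?\<sigma> (mpoly_const R)"
  proof -
    have "map_poly mpoly_const (map_poly (\<lambda>c. [:c:]) R) = map_poly (\<lambda>c. mpoly_const [:c:]) R"
      by (rule poly_eqI) (simp add: coeff_map_poly type_hom_zero[OF type_hom_mpoly_const])
    then show ?thesis by (simp add: Pt_def shift_subst_def translate_const)
  qed
  have "?\<tau> Pt = mpoly_const R" unfolding Pt by (rule translate_translate[OF fixed])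
  moreover have "?\<tau> (A * B) = ?\<tau> (mpoly_const b * Pt)" using AB by (simp add: Pt_def)
  ultimately have \<tau>AB: "?\<tau> A * ?\<tau> B = mpoly_const R * ?\<tau> (mpoly_const b)"
    by (simp add: type_hom_mult[OF type_hom_translate] mult.commute)
  have R0: "R \<noteq> 0" using R by (auto simp: Factorial_Ring.irreducible_def)
  then have "Pt \<noteq> 0"
    using \<open>?\<tau> Pt = mpoly_const R\<close> type_hom_zero[OF type_hom_translate] type_hom_zero[OF type_hom_mpoly_const]
    by (metis mpoly_const_inject)
  have const: "\<exists>\<beta>. D = mpoly_const \<beta>"
    if "\<forall>m. R dvd Poly_Mapping.lookup (?\<tau> C) m" "C * D = mpoly_const b * Pt" for C D
  proof -
    define E where "E = Poly_Mapping.map (\<lambda>x. x div R) (?\<tau> C)"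
    have "?\<tau> C = mpoly_const R * E"
      by (rule poly_mapping_eqI) (use that(1) in \<open>auto simp: E_def lookup_const_mult lookup_map\<close>)
    then have "C = Pt * ?\<sigma> E" using \<sigma>\<tau>[of C] by (simp add: type_hom_mult[OF type_hom_translate] Pt)
    then have "Pt * (D * ?\<sigma> E) = Pt * mpoly_const b" using that(2) by (simp add: ac_simps)
    then have "D * ?\<sigma> E = mpoly_const b" using \<open>Pt \<noteq> 0\<close> mult_left_cancel by blast
    from factor_of_const[OF this b] show ?thesis by blast
  qed
  have "prime_elem R" by (rule field_poly_irreducible_imp_prime[OF R])
  then have "primeideal {f. R dvd f} type_ring" by (rule prime_elem_primeideal)
  moreover have "Poly_Mapping.lookup (?\<tau> A * ?\<tau> B) m \<in> {f. R dvd f}" for m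
    unfolding \<tau>AB lookup_const_mult by simp
  ultimately have "(\<forall>m. R dvd Poly_Mapping.lookup (?\<tau> A) m) \<or> (\<forall>m. R dvd Poly_Mapping.lookup (?\<tau> B) m)"
    using gauss_mpoly[of "{f. R dvd f}" "?\<tau> A" "?\<tau> B"] by auto
  then show ?thesis
    using const[of A B] const[of B A] AB by (auto simp: Pt_def mult.commute)
qed

section \<open>Rational functions in one parameter\<close>

abbreviation var0 :: "'b::comm_ring_1 mpoly"
  where "var0 \<equiv> Poly_Mapping.single (Poly_Mapping.single 0 (Suc 0)) 1"

text \<open>The bridge from univariate polynomials, used in the primality argument, to the parameter
  ring of the Hilbert property, whose T is the variable of index 0.\<close>

definition mpoly_of_poly :: "'b::comm_ring_1 poly \<Rightarrow> 'b mpoly"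
  where "mpoly_of_poly = shift_subst 0 (Poly_Mapping.single 0 (Suc 0))"

lemma type_hom_mpoly_of_poly: "type_hom mpoly_of_poly"
  unfolding mpoly_of_poly_def by (rule type_hom_shift_subst)

lemma single_0_1_neq_0: "Poly_Mapping.single 0 (Suc 0) \<noteq> (0 :: nat \<Rightarrow>\<^sub>0 nat)"
  by (metis lookup_single_eq lookup_zero nat.distinct(1))

lemma mpoly_of_poly_altdef: "mpoly_of_poly f = poly (map_poly mpoly_const f) var0"
  by (simp add: mpoly_of_poly_def shift_subst_def type_hom_zero[OF type_hom_mpoly_const])

lemma mpoly_of_poly_eq_0_iff: "mpoly_of_poly f = 0 \<longleftrightarrow> f = 0"
proof
  assume "mpoly_of_poly f = 0"
  then have "Polynomial.coeff f j = 0" for j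
    using lookup_shift_subst[OF single_0_1_neq_0, of 0 f j]
    by (simp add: mpoly_of_poly_def pcompose_idR)
  then show "f = 0" by (intro poly_eqI) simp
qed (simp add: type_hom_zero[OF type_hom_mpoly_of_poly])

lemma mpoly_of_poly_const: "mpoly_of_poly [:c:] = mpoly_const c"
  by (simp add: mpoly_of_poly_altdef map_poly_pCons type_hom_zero[OF type_hom_mpoly_const])

lemma mpoly_of_poly_X: "mpoly_of_poly [:0, 1:] = var0"
  by (simp add: mpoly_of_poly_altdef map_poly_pCons type_hom_zero[OF type_hom_mpoly_const]
      type_hom_one[OF type_hom_mpoly_const])

lemma mpoly_of_poly_surj:
  assumes "p \<in> carrier (mpoly_ring 1 UNIV)"
  shows "\<exists>f. p = mpoly_of_poly f"
proof -
  let ?f = "\<Sum>m\<in>Poly_Mapping.keys p. Polynomial.monom (Poly_Mapping.lookup p m) (Poly_Mapping.lookup m 0)"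
  have "mpoly_of_poly (Polynomial.monom (Poly_Mapping.lookup p m) (Poly_Mapping.lookup m 0))
      = Poly_Mapping.single m (Poly_Mapping.lookup p m)" if m: "m \<in> Poly_Mapping.keys p" for m
  proof -
    have "Poly_Mapping.keys m \<subseteq> {0}" using assms m by (auto simp: carrier_mpoly_ring_iff)
    then have "Poly_Mapping.lookup m i = 0" if "i \<noteq> 0" for i
      using that by (auto simp: in_keys_iff)
    then have "exponent_scale (Poly_Mapping.lookup m 0) (Poly_Mapping.single 0 (Suc 0)) = m"
      by (intro poly_mapping_eqI) (auto simp: lookup_single when_def)
    then show ?thesis
      by (simp add: mpoly_of_poly_altdef map_poly_monom type_hom_zero[OF type_hom_mpoly_const] poly_monom
          single_power mpoly_const_single[symmetric])
  qed
  then have "mpoly_of_poly ?f = (\<Sum>m\<in>Poly_Mapping.keys p. Poly_Mapping.single m (Poly_Mapping.lookup p m))"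
    unfolding type_hom_sum[OF type_hom_mpoly_of_poly] by (intro sum.cong) auto
  then show ?thesis using poly_mapping_sum_singles[of p] by metis
qed

definition rat_fun_of_poly :: "'b::field poly \<Rightarrow> 'b mpoly fract"
  where "rat_fun_of_poly f = to_fract (mpoly_of_poly f)"

lemma type_hom_rat_fun_of_poly: "type_hom rat_fun_of_poly"
  unfolding rat_fun_of_poly_def by (rule type_hom_comp[OF type_hom_to_fract type_hom_mpoly_of_poly])

lemma rat_fun_of_poly_eq_0_iff: "rat_fun_of_poly f = 0 \<longleftrightarrow> f = 0"
  by (simp add: rat_fun_of_poly_def mpoly_of_poly_eq_0_iff)

lemma rat_fun_of_poly_inject: "rat_fun_of_poly f = rat_fun_of_poly g \<longleftrightarrow> f = g"
  using rat_fun_of_poly_eq_0_iff[of "f - g"]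
    type_hom_add[OF type_hom_rat_fun_of_poly, of f "- g"] type_hom_uminus[OF type_hom_rat_fun_of_poly, of g]
  by simp

lemma rat_funs_denominator:
  assumes "c \<in> rat_funs 1"
  shows "\<exists>x y. y \<noteq> 0 \<and> rat_fun_of_poly y * c = rat_fun_of_poly x"
proof -
  obtain a b where ab: "c = Fraction_Field.Fract a b" "a \<in> carrier (mpoly_ring 1 UNIV)"
    "b \<in> carrier (mpoly_ring 1 UNIV)" "b \<noteq> 0"
    using assms unfolding rat_funs_def by blast
  obtain x y where xy: "a = mpoly_of_poly x" "b = mpoly_of_poly y"
    using mpoly_of_poly_surj ab(2,3) by blast
  have "y \<noteq> 0" using ab(4) by (simp add: xy mpoly_of_poly_eq_0_iff)
  moreover have "rat_fun_of_poly y * c = rat_fun_of_poly x"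
    using ab(1,4) by (simp add: rat_fun_of_poly_def xy to_fract_def eq_fract)
  ultimately show ?thesis by blast
qed

lemma rat_funs_common_denominator:
  assumes "finite C" "C \<subseteq> rat_funs 1"
  shows "\<exists>y. y \<noteq> 0 \<and> (\<forall>c\<in>C. \<exists>x. rat_fun_of_poly y * c = rat_fun_of_poly x)"
  using assms
proof (induction C rule: finite_induct)
  case empty
  show ?case by (intro exI[of _ 1]) simp
next
  case (insert c C)
  then obtain y where y: "y \<noteq> 0" "\<And>c. c \<in> C \<Longrightarrow> \<exists>x. rat_fun_of_poly y * c = rat_fun_of_poly x" by auto
  obtain x' y' where y': "y' \<noteq> 0" "rat_fun_of_poly y' * c = rat_fun_of_poly x'"
    using rat_funs_denominator[of c] insert.prems by blast
  note mult = type_hom_mult[OF type_hom_rat_fun_of_poly]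
  have "\<exists>x. rat_fun_of_poly (y * y') * c' = rat_fun_of_poly x" if "c' \<in> insert c C" for c'
  proof (cases "c' = c")
    case True
    have "rat_fun_of_poly (y * y') * c = rat_fun_of_poly (y * x')" by (simp add: mult y'(2) mult.assoc)
    then show ?thesis using True by blast
  next
    case False
    then obtain x where x: "rat_fun_of_poly y * c' = rat_fun_of_poly x" using y(2) \<open>c' \<in> insert c C\<close> by blast
    have "rat_fun_of_poly (y * y') * c' = rat_fun_of_poly (y' * x)"
      by (simp add: mult x[symmetric] ac_simps)
    then show ?thesis by blast
  qed
  then show ?case using y(1) y'(1) by (intro exI[of _ "y * y'"]) auto
qed

lemma clear_denominators:
  assumes "f \<in> carrier (mpoly_ring n (rat_funs 1))"
  shows "\<exists>y f0. y \<noteq> 0 \<and> mpoly_const (rat_fun_of_poly y) * f = Poly_Mapping.map rat_fun_of_poly f0"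
proof -
  have "Poly_Mapping.lookup f ` Poly_Mapping.keys f \<subseteq> rat_funs 1"
    using assms by (auto simp: carrier_mpoly_ring_iff)
  from rat_funs_common_denominator[OF _ this] obtain y x where y: "y \<noteq> 0"
    "\<And>m. m \<in> Poly_Mapping.keys f \<Longrightarrow> rat_fun_of_poly y * Poly_Mapping.lookup f m = rat_fun_of_poly (x m)"
    by (simp add: image_iff) metis
  define f0 where "f0 = (\<Sum>m\<in>Poly_Mapping.keys f. Poly_Mapping.single m (x m))"
  have "Poly_Mapping.lookup f0 m = (if m \<in> Poly_Mapping.keys f then x m else 0)" for m
    by (auto simp: f0_def lookup_sum lookup_single when_def sum.delta')
  then have "mpoly_const (rat_fun_of_poly y) * f = Poly_Mapping.map rat_fun_of_poly f0"
    by (intro poly_mapping_eqI)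
      (auto simp: lookup_const_mult lookup_map type_hom_zero[OF type_hom_rat_fun_of_poly] y(2)
        not_in_keys_iff_lookup_eq_zero)
  then show ?thesis using y(1) by blast
qed

lemma rat_funsI:
  "a \<in> carrier (mpoly_ring k UNIV) \<Longrightarrow> b \<in> carrier (mpoly_ring k UNIV) \<Longrightarrow> b \<noteq> 0 \<Longrightarrow>
    Fraction_Field.Fract a b \<in> rat_funs k"
  unfolding rat_funs_def by blast

lemma const_Units_rat_funs:
  fixes f :: "'b::field mpoly fract mpoly"
  assumes "f \<in> carrier (mpoly_ring n (rat_funs k))" "f = mpoly_const (Poly_Mapping.lookup f 0)" "f \<noteq> 0"
  shows "f \<in> Units (mpoly_ring n (rat_funs k))"
proof -
  let ?c = "Poly_Mapping.lookup f 0"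
  have c: "?c \<in> rat_funs k" "?c \<noteq> 0"
    using assms type_hom_zero[OF type_hom_mpoly_const] by (auto simp: carrier_mpoly_ring_iff)
  then obtain a b where ab: "?c = Fraction_Field.Fract a b" "a \<in> carrier (mpoly_ring k UNIV)"
    "b \<in> carrier (mpoly_ring k UNIV)" "b \<noteq> 0"
    unfolding rat_funs_def by blast
  have "a \<noteq> 0" using c(2) ab by (auto simp: fract_collapse)
  then have "inverse ?c \<in> rat_funs k" using rat_funsI[of b k a] ab by simp
  moreover have "(0 :: 'b mpoly fract) \<in> rat_funs k"
  proof -
    have "0 \<in> carrier (mpoly_ring k (UNIV :: 'b set))" "1 \<in> carrier (mpoly_ring k (UNIV :: 'b set))"
      using type_subring_mpoly_ring[OF type_subring_UNIV, of k] by (auto simp: type_subring_def)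
    moreover have "(0 :: 'b mpoly fract) = Fraction_Field.Fract 0 1" by (simp add: Zero_fract_def)
    ultimately show ?thesis using rat_funsI[of "0 :: 'b mpoly" k 1] by simp
  qed
  ultimately have "mpoly_const (inverse ?c) \<in> carrier (mpoly_ring n (rat_funs k))"
    by (intro mpoly_const_carrier)
  moreover have "f * mpoly_const (inverse ?c) = 1"
    using c(2) by (subst assms(2)) (simp add: type_hom_one[OF type_hom_mpoly_const]
        flip: type_hom_mult[OF type_hom_mpoly_const])
  ultimately show ?thesis using assms(1) by (auto simp: Units_mpoly_ring_iff)
qed

lemma lead_coeff_shift:
  fixes p :: "'a::idom poly"
  shows "Polynomial.coeff (pcompose p [:a, 1:]) (Polynomial.degree p) = lead_coeff p"
  using lead_coeff_comp[of "[:a, 1:]" p] degree_pcompose[of p "[:a, 1:]"] by simp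

lemma irreducible_degree_pos:
  assumes "Factorial_Ring.irreducible (p :: 'a::field poly)"
  shows "Polynomial.degree p > 0"
  using assms by (auto simp: Factorial_Ring.irreducible_def is_unit_iff_degree intro: ccontr)

lemma shift_subst_nonconst:
  fixes p :: "'a::idom poly"
  assumes "d \<noteq> 0" "Polynomial.degree p > 0"
  shows "shift_subst a d p \<noteq> mpoly_const c"
proof
  assume *: "shift_subst a d p = mpoly_const c"
  have "exponent_scale 0 d = 0" by (rule poly_mapping_eqI) simp
  then have "exponent_scale (Polynomial.degree p) d \<noteq> 0"
    using exponent_scale_inject[OF assms(1), of "Polynomial.degree p" 0] assms(2) by simp
  then have "lead_coeff p = 0"
    using lookup_shift_subst[OF assms(1), of a p "Polynomial.degree p"]
    by (simp add: * lookup_mpoly_const lead_coeff_shift)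
  then show False using assms(2) by auto
qed

text \<open>Multiplying the factors by common denominators y and z moves the factorization into
  K[T][Y] at the cost of the factor yz. There one factor is free of Y, so the original one is a
  nonzero element of K(T), a unit.\<close>

theorem shift_subst_irreducible:
  fixes R :: "'b::field poly"
  assumes R: "Factorial_Ring.irreducible R" and d: "d \<noteq> 0"
  shows "ring_irreducible\<^bsub>mpoly_ring n (rat_funs 1)\<^esub>
    (shift_subst (to_fract var0) d (map_poly (\<lambda>c. to_fract (mpoly_const c)) R))"
    (is "ring_irreducible\<^bsub>?M\<^esub> ?P")
proof (rule mpoly_ring_irreducibleI)
  note hom = type_hom_rat_fun_of_poly
  note map_hom = type_hom_map[OF hom]
  let ?h = "\<lambda>c. to_fract (mpoly_const c) :: 'b mpoly fract"
  have h0: "?h c = 0 \<longleftrightarrow> c = 0" for c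
    using mpoly_const_inject[of c 0] by (simp add: type_hom_zero[OF type_hom_mpoly_const] del: mpoly_const_inject)
  have "Polynomial.degree (map_poly ?h R) = Polynomial.degree R"
    by (rule degree_map_poly) (simp add: h0)
  then have deg: "Polynomial.degree (map_poly ?h R) > 0" using irreducible_degree_pos[OF R] by simp
  have nonconst: "?P \<noteq> mpoly_const c" for c by (rule shift_subst_nonconst[OF d deg])
  show "?P \<noteq> 0" using nonconst[of 0] by (simp add: type_hom_zero[OF type_hom_mpoly_const])
  show "?P \<notin> Units ?M"
  proof
    assume "?P \<in> Units ?M"
    then obtain y where "?P * y = mpoly_const 1"
      by (auto simp: Units_mpoly_ring_iff type_hom_one[OF type_hom_mpoly_const])
    from factor_of_const[OF this] nonconst show False by simp
  qed
  fix A B assume A: "A \<in> carrier ?M" and B: "B \<in> carrier ?M" and AB: "?P = A * B"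
  let ?Q = "shift_subst [:0, 1:] d (map_poly (\<lambda>c. [:c:]) R)"
  have P0: "Poly_Mapping.map rat_fun_of_poly ?Q = ?P"
  proof -
    have "map_poly rat_fun_of_poly (map_poly (\<lambda>c. [:c:]) R) = map_poly ?h R"
      by (rule poly_eqI, simp add: coeff_map_poly type_hom_zero[OF hom])
        (simp add: rat_fun_of_poly_def mpoly_of_poly_const)
    then show ?thesis
      unfolding map_shift_subst[OF hom] by (simp add: rat_fun_of_poly_def mpoly_of_poly_X)
  qed
  obtain y A0 where y: "y \<noteq> 0" "mpoly_const (rat_fun_of_poly y) * A = Poly_Mapping.map rat_fun_of_poly A0"
    using clear_denominators[OF A] by blast
  obtain z B0 where z: "z \<noteq> 0" "mpoly_const (rat_fun_of_poly z) * B = Poly_Mapping.map rat_fun_of_poly B0"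
    using clear_denominators[OF B] by blast
  have "Poly_Mapping.map rat_fun_of_poly (A0 * B0)
      = (mpoly_const (rat_fun_of_poly y) * A) * (mpoly_const (rat_fun_of_poly z) * B)"
    by (simp add: type_hom_mult[OF map_hom] y(2) z(2))
  also have "\<dots> = mpoly_const (rat_fun_of_poly (y * z)) * ?P"
    by (simp only: AB type_hom_mult[OF hom] type_hom_mult[OF type_hom_mpoly_const] mult_ac)
  also have "\<dots> = Poly_Mapping.map rat_fun_of_poly (mpoly_const (y * z) * ?Q)"
    by (simp add: type_hom_mult[OF map_hom] P0 map_mpoly_const[OF hom])
  finally have eq: "Poly_Mapping.map rat_fun_of_poly (A0 * B0)
    = Poly_Mapping.map rat_fun_of_poly (mpoly_const (y * z) * ?Q)" .
  have "A0 * B0 = mpoly_const (y * z) * ?Q"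
  proof (rule poly_mapping_eqI)
    fix m
    show "Poly_Mapping.lookup (A0 * B0) m = Poly_Mapping.lookup (mpoly_const (y * z) * ?Q) m"
      using arg_cong[OF eq, of "\<lambda>p. Poly_Mapping.lookup p m"]
      by (simp only: lookup_map[of rat_fun_of_poly, OF type_hom_zero[OF hom]] rat_fun_of_poly_inject)
  qed
  from shift_subst_factor[OF R _ this] y(1) z(1)
  have factor: "(\<exists>\<beta>. A0 = mpoly_const \<beta>) \<or> (\<exists>\<beta>. B0 = mpoly_const \<beta>)" by simp
  have unit: "C \<in> Units ?M"
    if C: "C \<in> carrier ?M" "C \<noteq> 0" and x: "x \<noteq> 0"
      and eq: "mpoly_const (rat_fun_of_poly x) * C = Poly_Mapping.map rat_fun_of_poly (mpoly_const \<beta>)" for C x \<beta>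
  proof (rule const_Units_rat_funs[OF C(1) _ C(2)])
    have "Poly_Mapping.lookup C m = 0" if "m \<noteq> 0" for m
    proof -
      have "rat_fun_of_poly x * Poly_Mapping.lookup C m = 0"
        using arg_cong[OF eq, of "\<lambda>p. Poly_Mapping.lookup p m"] that
        by (simp add: lookup_const_mult map_mpoly_const[OF hom] lookup_mpoly_const)
      then show ?thesis using x by (simp add: rat_fun_of_poly_eq_0_iff)
    qed
    then show "C = mpoly_const (Poly_Mapping.lookup C 0)"
      by (intro poly_mapping_eqI) (simp add: lookup_mpoly_const)
  qed
  have "A \<noteq> 0" "B \<noteq> 0" using \<open>?P \<noteq> 0\<close> AB by auto
  then show "A \<in> Units ?M \<or> B \<in> Units ?M"
    using factor unit[OF A _ y(1)] unit[OF B _ z(1)] y(2) z(2) by metis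
qed

section \<open>Affine substitutions\<close>

lemma irreducible_pcompose_linear:
  fixes p :: "'b::field poly"
  assumes p: "Factorial_Ring.irreducible p" and w: "w \<noteq> 0"
  shows "Factorial_Ring.irreducible (pcompose p [:t, w:])"
proof (rule Factorial_Ring.irreducibleI)
  let ?L = "[:t, w:]" and ?L' = "[:- t / w, 1 / w:]"
  have deg: "Polynomial.degree (pcompose f ?L) = Polynomial.degree f"
    "Polynomial.degree (pcompose f ?L') = Polynomial.degree f" for f
    using w by (simp_all add: degree_pcompose)
  have pos: "Polynomial.degree (pcompose p ?L) > 0" using irreducible_degree_pos[OF p] deg(1) by simp
  then show "pcompose p ?L \<noteq> 0" by auto
  then show "\<not> pcompose p ?L dvd 1" using pos by (simp add: is_unit_iff_degree)
  fix a b assume ab: "pcompose p ?L = a * b"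
  have "pcompose ?L ?L' = [:0, 1:]" using w by (simp add: pcompose_pCons)
  then have "pcompose (pcompose p ?L) ?L' = p" by (simp add: pcompose_assoc[symmetric] pcompose_idR)
  then have "p = pcompose a ?L' * pcompose b ?L'" by (simp add: ab pcompose_mult)
  from Factorial_Ring.irreducibleD[OF p this]
  have "pcompose a ?L' dvd 1 \<or> pcompose b ?L' dvd 1" .
  moreover have "a \<noteq> 0" "b \<noteq> 0" using ab \<open>pcompose p ?L \<noteq> 0\<close> by auto
  moreover have "c dvd 1" if "pcompose c ?L' dvd 1" "c \<noteq> 0" for c
  proof -
    have "pcompose c ?L' \<noteq> 0" using that(1) by auto
    then show ?thesis using that deg(2)[of c] by (simp add: is_unit_iff_degree)
  qed
  ultimately show "a dvd 1 \<or> b dvd 1" by blast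
qed

lemma pcompose_affine_expand:
  fixes P :: "'a::comm_ring_1 poly"
  shows "\<exists>h. pcompose P [:t, w:] = [:poly P t:] + Polynomial.smult w h"
proof (induction P)
  case (pCons a P)
  then obtain h where h: "pcompose P [:t, w:] = [:poly P t:] + Polynomial.smult w h" by blast
  have "pcompose (pCons a P) [:t, w:] =
      [:a:] + Polynomial.smult t ([:poly P t:] + Polynomial.smult w h) + Polynomial.smult w (pCons 0 (pcompose P [:t, w:]))"
    by (simp add: pcompose_pCons h add.assoc)
  also have "\<dots> = [:poly (pCons a P) t:] + Polynomial.smult w (Polynomial.smult t h + pCons 0 (pcompose P [:t, w:]))"
    by (simp add: smult_add_right mult.commute)
  finally show ?case by blast
qed (auto intro: exI[of _ 0])

text \<open>Passing to g(X^e) loses no coefficient of g, so information at e-th powers alone still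
  determines g modulo \<open>q\<close>.\<close>

lemma coeff_pcompose_monom:
  fixes g :: "'a::comm_ring_1 poly"
  assumes "e > 0"
  shows "Polynomial.coeff (pcompose g (Polynomial.monom 1 e)) (k * e) = Polynomial.coeff g k"
proof (induction g arbitrary: k)
  case (pCons a g)
  show ?case
  proof (cases k)
    case 0
    then show ?thesis using assms by (simp add: pcompose_pCons coeff_monom_mult)
  next
    case (Suc j)
    then show ?thesis
      using assms pCons.IH[of j] by (simp add: pcompose_pCons coeff_monom_mult coeff_pCons split: nat.split)
  qed
qed simp

section \<open>The specialized polynomials\<close>

lemma type_hom_fract_mpoly: "type_hom (fract_mpoly :: 'a::idom mpoly \<Rightarrow> _)"
  using type_hom_map[OF type_hom_to_fract] by (simp add: fract_mpoly_def[abs_def])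

lemma fract_mpoly_const [simp]: "fract_mpoly (mpoly_const c) = mpoly_const (to_fract c)"
  by (simp add: fract_mpoly_def map_mpoly_const type_hom_to_fract)

lemma fract_mpoly_var0 [simp]: "fract_mpoly var0 = var0"
  unfolding fract_mpoly_def
  by (rule poly_mapping_eqI) (simp add: lookup_map lookup_single when_def)

lemma lookup_fract_mpoly: "Poly_Mapping.lookup (fract_mpoly p) m = to_fract (Poly_Mapping.lookup p m)"
  by (simp add: fract_mpoly_def lookup_map)

lemma to_QT_Y_shift_subst:
  "to_QT_Y (shift_subst var0 d (map_poly mpoly_const R)) =
    shift_subst var0 d (map_poly mpoly_const (fract_poly R))"
proof -
  have "map_poly fract_mpoly (map_poly mpoly_const R) = map_poly mpoly_const (fract_poly R)"
    by (rule poly_eqI) (simp add: coeff_map_poly type_hom_zero[OF type_hom_fract_mpoly])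
  then show ?thesis by (simp add: to_QT_Y_def map_shift_subst[OF type_hom_fract_mpoly])
qed

lemma to_rat_QT_Y_shift_subst:
  "to_rat_QT_Y (shift_subst var0 d (map_poly mpoly_const R)) =
    shift_subst (to_fract var0) d (map_poly (\<lambda>c. to_fract (mpoly_const c)) (fract_poly R))"
proof -
  have "map_poly to_fract (map_poly mpoly_const (fract_poly R)) =
      map_poly (\<lambda>c. to_fract (mpoly_const c)) (fract_poly R)"
    by (rule poly_eqI) (simp add: coeff_map_poly)
  then show ?thesis
    by (simp add: to_rat_QT_Y_def to_QT_Y_shift_subst map_shift_subst[OF type_hom_to_fract])
qed

lemma specialize_shift_subst:
  "specialize m (shift_subst var0 d (map_poly mpoly_const R)) = shift_subst (m 0) d R"
proof -
  have "map_poly (mpoly_eval m) (map_poly mpoly_const R) = R"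
    by (rule poly_eqI) (simp add: coeff_map_poly type_hom_zero[OF type_hom_mpoly_eval])
  then show ?thesis
    by (simp add: specialize_def map_shift_subst[OF type_hom_mpoly_eval] mpoly_eval_single)
qed

text \<open>The coefficient of the top power of Y^d is the leading coefficient of R, a nonzero
  element of the fraction field and hence a unit.\<close>

lemma primitive_wrt_QT_shift_subst:
  fixes R :: "'a::idom poly"
  assumes "d \<noteq> 0" "R \<noteq> 0"
  shows "primitive_wrt_QT k (shift_subst var0 d (map_poly mpoly_const R))"
  unfolding primitive_wrt_QT_def
proof (intro ballI impI)
  let ?C = "carrier (mpoly_ring k (UNIV :: 'a fract set))"
  let ?F = "map_poly mpoly_const (fract_poly R) :: 'a fract mpoly poly"
  fix c :: "'a fract mpoly"
  assume c: "c \<in> ?C"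
    and dvd: "\<forall>m. c divides\<^bsub>mpoly_ring k UNIV\<^esub> Poly_Mapping.lookup
      (to_QT_Y (shift_subst var0 d (map_poly mpoly_const R))) m"
  have "Poly_Mapping.lookup (shift_subst var0 d ?F) (exponent_scale (Polynomial.degree ?F) d) = lead_coeff ?F"
    by (simp add: lookup_shift_subst[OF assms(1)] lead_coeff_shift)
  also have "\<dots> = mpoly_const (lead_coeff (fract_poly R))"
    by (simp add: degree_map_poly coeff_map_poly)
  finally have "c divides\<^bsub>mpoly_ring k UNIV\<^esub> mpoly_const (lead_coeff (fract_poly R))"
    using dvd unfolding to_QT_Y_shift_subst by metis
  then obtain y where y: "y \<in> ?C" "mpoly_const (lead_coeff (fract_poly R)) = c * y"
    by (auto simp: factor_def)
  let ?b = "inverse (lead_coeff (fract_poly R))"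
  have "lead_coeff (fract_poly R) \<noteq> 0" using assms(2) by simp
  then have "mpoly_const (lead_coeff (fract_poly R)) * mpoly_const ?b = 1"
    by (simp flip: type_hom_mult[OF type_hom_mpoly_const])
  then have "c * (y * mpoly_const ?b) = 1" by (simp add: y(2) mult.assoc)
  moreover have "y * mpoly_const ?b \<in> ?C"
    using y(1) type_subring_mpoly_ring[OF type_subring_UNIV, of k] mpoly_const_carrier[of UNIV ?b k]
    by (auto simp: type_subring_def)
  ultimately show "c \<in> Units (mpoly_ring k UNIV)" using c by (auto simp: Units_mpoly_ring_iff)
qed

lemma shift_subst_affine:
  "shift_subst a d (pcompose P [:t, w:]) =
    subst_mpoly P (mpoly_const t + mpoly_const w * (mpoly_const a + Poly_Mapping.single d 1))"
  by (simp add: shift_subst_def subst_mpoly_def map_poly_pcompose[OF type_hom_mpoly_const] poly_pcompose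
      map_poly_pCons mult.commute)

lemma mpoly_eval_shift_subst:
  "mpoly_eval y (shift_subst a d p) =
    poly (pcompose p [:a, 1:]) (\<Prod>i\<in>Poly_Mapping.keys d. y i ^ Poly_Mapping.lookup d i)"
proof -
  have "map_poly (mpoly_eval y) (map_poly mpoly_const (pcompose p [:a, 1:])) = pcompose p [:a, 1:]"
    by (rule poly_eqI) (simp add: coeff_map_poly type_hom_zero[OF type_hom_mpoly_eval])
  then show ?thesis
    unfolding shift_subst_altdef by (simp add: type_hom_poly[OF type_hom_mpoly_eval] mpoly_eval_single)
qed

text \<open>A factor that is a unit over the fraction field is a constant of the ring, and it
  divides all coefficients of G * H. \<open>H\<close> collects the other polynomials, because the
  Hilbert property bounds only the content of the product.\<close>

lemma mpoly_ring_irreducible_of_fract: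
  fixes G H :: "'a::idom mpoly"
  assumes irr: "ring_irreducible\<^bsub>mpoly_ring n UNIV\<^esub> (fract_mpoly G)"
    and nonconst: "\<And>c. G \<noteq> mpoly_const c"
    and no_divisor: "\<not> (\<exists>I\<in>Nonunit. vanishes_mod I (G * H))"
  shows "ring_irreducible\<^bsub>mpoly_ring n UNIV\<^esub> G"
proof (rule mpoly_ring_irreducibleI)
  show "G \<noteq> 0" using nonconst[of 0] by simp
  show "G \<notin> Units (mpoly_ring n UNIV)"
  proof
    assume "G \<in> Units (mpoly_ring n UNIV)"
    then obtain y where "G * y = mpoly_const 1" by (auto simp: Units_mpoly_ring_iff)
    from factor_of_const[OF this] nonconst show False by simp
  qed
  have unit: "b \<in> Units (mpoly_ring n UNIV)"
    if b: "b \<in> carrier (mpoly_ring n UNIV)" "G = b * c" "fract_mpoly b \<in> Units (mpoly_ring n UNIV)" for b c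
  proof -
    obtain y where "fract_mpoly b * y = mpoly_const 1" using b(3) by (auto simp: Units_mpoly_ring_iff)
    then have const: "fract_mpoly b = mpoly_const (Poly_Mapping.lookup (fract_mpoly b) 0)"
      by (rule factor_of_const) simp
    define \<beta> where "\<beta> = Poly_Mapping.lookup b 0"
    have "to_fract (Poly_Mapping.lookup b m) = to_fract (Poly_Mapping.lookup (mpoly_const \<beta>) m)" for m
      using arg_cong[OF const, of "\<lambda>p. Poly_Mapping.lookup p m"]
      by (simp add: lookup_fract_mpoly lookup_mpoly_const \<beta>_def split: if_splits)
    then have b_const: "b = mpoly_const \<beta>" by (intro poly_mapping_eqI) simp
    have "\<beta> dvd 1"
    proof (rule ccontr)
      assume "\<not> \<beta> dvd 1"
      moreover have "\<beta> \<noteq> 0" using b(2) \<open>G \<noteq> 0\<close> b_const by auto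
      ultimately have "{x. \<beta> dvd x} \<in> Nonunit" unfolding Nonunit_iff by blast
      moreover have "vanishes_mod {x. \<beta> dvd x} (G * H)"
        by (simp add: vanishes_mod_def b(2) b_const mult.assoc lookup_const_mult)
      ultimately show False using no_divisor by blast
    qed
    then obtain \<gamma> where "1 = \<beta> * \<gamma>" by blast
    then have "b * mpoly_const \<gamma> = 1"
      unfolding b_const by (simp flip: type_hom_mult[OF type_hom_mpoly_const])
    then show ?thesis
      using b(1) mpoly_const_carrier[of UNIV \<gamma> n] by (auto simp: Units_mpoly_ring_iff)
  qed
  fix b c assume b: "b \<in> carrier (mpoly_ring n UNIV)" and c: "c \<in> carrier (mpoly_ring n UNIV)"
    and G: "G = b * c"
  have "fract_mpoly b \<in> carrier (mpoly_ring n UNIV)" "fract_mpoly c \<in> carrier (mpoly_ring n UNIV)"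
    using b c by (auto simp: carrier_mpoly_ring_iff in_keys_iff lookup_fract_mpoly)
  moreover have "fract_mpoly G = fract_mpoly b * fract_mpoly c"
    by (simp add: G type_hom_mult[OF type_hom_fract_mpoly])
  ultimately have "fract_mpoly b \<in> Units (mpoly_ring n UNIV) \<or> fract_mpoly c \<in> Units (mpoly_ring n UNIV)"
    by (rule mpoly_ring_irreducibleD[OF irr])
  then show "b \<in> Units (mpoly_ring n UNIV) \<or> c \<in> Units (mpoly_ring n UNIV)"
    using unit[OF b G] unit[OF c, of b] G by (auto simp: mult.commute)
qed

lemma zariski_dense_nonempty:
  assumes "zariski_dense k (H :: (nat \<Rightarrow> 'a::idom) set)"
  shows "H \<noteq> {}"
proof
  assume "H = {}"
  moreover have "(1 :: 'a fract mpoly) \<in> carrier (mpoly_ring k UNIV)"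
    using type_subring_mpoly_ring[OF type_subring_UNIV, of k] by (auto simp: type_subring_def)
  ultimately show False
    using assms unfolding zariski_dense_def by (metis empty_iff zero_neq_one)
qed

text \<open>The first crossing, from values to values: it verifies the fixed divisor hypothesis of
  the Hilbert property. A pair is detected through the values of P; many residues carry membership
  in \<open>q\<close> from the values of P(t + wX) to its coefficients, then to those of P.\<close>

lemma adjusted_values_not_in_nonunit:
  assumes detects: "detects_nonunits Fam"
    and adjusted: "\<And>p q. (p, q) \<in> Fam \<Longrightarrow> adjusted_at (Suc N) P t w p q"
    and no_divisor: "\<not> (\<exists>I\<in>Nonunit. range (poly P) \<subseteq> I)"
    and N: "Polynomial.degree P \<le> N" and I: "I \<in> Nonunit"
  shows "\<exists>z. poly (pcompose P [:t, w:]) z \<notin> I"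
proof (rule ccontr)
  assume "\<not> ?thesis"
  then have *: "poly (pcompose P [:t, w:]) z \<in> I" for z by blast
  obtain c where c: "c \<noteq> 0" "\<not> c dvd 1" "I = {x. c dvd x}" using I unfolding Nonunit_iff by blast
  obtain p q where pq: "(p, q) \<in> Fam" "c \<in> q" "\<not> range (poly P) \<subseteq> q"
    using detects no_divisor c(1,2) unfolding detects_nonunits_def by blast
  have prim: "primary_to p q" using detects pq(1) unfolding detects_nonunits_def by blast
  then have id: "ideal q type_ring" by (rule primary_to_ideal)
  then have "I \<subseteq> q" using c(3) ideal_dvd[OF id pq(2)] by blast
  with * have val: "poly (pcompose P [:t, w:]) z \<in> q" for z by blast
  \<comment> \<open>Since P has a value outside \<open>q\<close>, this single value excludes the
    second alternative of \<open>adjusted_at\<close>.\<close>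
  have "poly P (t + w * 0) \<in> q" using val[of 0] by (simp add: poly_pcompose)
  then obtain A where A: "w \<notin> p" "card A = Suc N" "separated_mod p A"
    using adjusted[OF pq(1)] pq(3) unfolding adjusted_at_def by blast
  have "Polynomial.degree (pcompose P [:t, w:]) \<le> Polynomial.degree P * Polynomial.degree [:t, w:]"
    by (rule degree_pcompose_le)
  also have "\<dots> \<le> Polynomial.degree P * 1" by (intro mult_le_mono) auto
  finally have "Polynomial.degree (pcompose P [:t, w:]) < card A" using N A(2) by simp
  moreover have "finite A" using A(2) by (metis card.infinite nat.distinct(1))
  ultimately have "Polynomial.coeff (pcompose P [:t, w:]) n \<in> q" for n
    using coeff_mem_if_values_mem[OF prim A(3)] val by blast
  then have "Polynomial.coeff P n \<in> q" for n
    by (rule coeff_mem_if_shift_coeff_mem[OF prim A(1)])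
  then have "range (poly P) \<subseteq> q" using poly_mem[OF id] by blast
  with pq(3) show False by contradiction
qed

text \<open>The second crossing: now a pair is detected through the coefficients of g, the
  information delivered by the Hilbert property. Each alternative of \<open>adjusted_at\<close>
  contradicts membership of all g(y^e) in \<open>q\<close>.\<close>

lemma adjusted_power_values_not_in_nonunit:
  fixes P :: "'a::idom poly"
  assumes detects: "detects_nonunits Fam"
    and adjusted: "\<And>p q. (p, q) \<in> Fam \<Longrightarrow> adjusted_at (Suc N) P t w p q"
    and "g = pcompose (pcompose P [:t, w:]) [:a, 1:]"
    and no_divisor: "\<not> (\<exists>I\<in>Nonunit. range (Polynomial.coeff g) \<subseteq> I)"
    and N: "Polynomial.degree P * e \<le> N" and e: "e > 0" and I: "I \<in> Nonunit"
  shows "\<exists>y. poly g (y ^ e) \<notin> I"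
proof (rule ccontr)
  assume "\<not> ?thesis"
  then have *: "poly g (y ^ e) \<in> I" for y by blast
  obtain c where c: "c \<noteq> 0" "\<not> c dvd 1" "I = {x. c dvd x}" using I unfolding Nonunit_iff by blast
  obtain p q where pq: "(p, q) \<in> Fam" "c \<in> q" "\<not> range (Polynomial.coeff g) \<subseteq> q"
    using detects no_divisor c(1,2) unfolding detects_nonunits_def by blast
  have prim: "primary_to p q" using detects pq(1) unfolding detects_nonunits_def by blast
  then have id: "ideal q type_ring" by (rule primary_to_ideal)
  then have "I \<subseteq> q" using c(3) ideal_dvd[OF id pq(2)] by blast
  with * have val: "poly g (y ^ e) \<in> q" for y by blast
  consider A where "card A = Suc N" "separated_mod p A"
    | "\<not> range (poly P) \<subseteq> q" "\<And>z. poly P (t + w * z) \<notin> q"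
    | "range (poly P) \<subseteq> q" "w \<in> q"
    using adjusted[OF pq(1)] unfolding adjusted_at_def by blast
  then show False
  proof cases
    case (1 A)
    let ?f = "pcompose g (Polynomial.monom 1 e)"
    have "Polynomial.degree g \<le> Polynomial.degree (pcompose P [:t, w:]) * Polynomial.degree [:a, 1:]"
      unfolding assms(3) by (rule degree_pcompose_le)
    also have "\<dots> \<le> Polynomial.degree P * Polynomial.degree [:t, w:] * Polynomial.degree [:a, 1:]"
      by (intro mult_le_mono degree_pcompose_le order.refl)
    also have "\<dots> \<le> Polynomial.degree P * 1 * 1" by (intro mult_le_mono) auto
    finally have "Polynomial.degree g \<le> Polynomial.degree P" by simp
    moreover have "Polynomial.degree ?f \<le> Polynomial.degree g * e"
      using degree_pcompose_le[of g "Polynomial.monom 1 e"] degree_monom_le[of 1 e]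
      by (meson mult_le_mono2 order.trans)
    ultimately have "Polynomial.degree ?f < card A" using N 1(1) mult_le_mono1 by (metis le_imp_less_Suc order.trans)
    moreover have "finite A" using 1(1) by (metis card.infinite nat.distinct(1))
    moreover have "poly ?f y \<in> q" for y using val[of y] by (simp add: poly_pcompose poly_monom)
    ultimately have "Polynomial.coeff ?f k \<in> q" for k
      using coeff_mem_if_values_mem[OF prim 1(2)] by blast
    from this[of "k * e" for k] have "Polynomial.coeff g k \<in> q" for k
      by (simp add: coeff_pcompose_monom[OF e])
    then show False using pq(3) by blast
  next
    case 2
    \<comment> \<open>The value at y = 1, where y^e = 1.\<close>
    have "poly P (t + w * (a + 1)) \<in> q"
      using val[of 1] by (simp add: assms(3) poly_pcompose mult.commute)
    then show False using 2(2) by blast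
  next
    case 3
    obtain h where h: "pcompose P [:t, w:] = [:poly P t:] + Polynomial.smult w h"
      using pcompose_affine_expand by blast
    \<comment> \<open>With \<open>w\<close> in \<open>q\<close> the polynomial P(t + wX) reduces to
      the constant P(t), which is 0 modulo \<open>q\<close>; so all coefficients of g vanish
      there.\<close>
    have "poly P t \<in> q" using 3(1) by blast
    then have "Polynomial.coeff (pcompose P [:t, w:]) k \<in> q" for k
      unfolding h using 3(2)
      by (auto simp: coeff_pCons ideal_zero[OF id] split: nat.split
          intro!: ideal_add[OF id] ideal_mult_right[OF id])
    then have "Polynomial.coeff g k \<in> q" for k
      unfolding assms(3) by (rule coeff_pcompose_mem[OF id])
    then show False using pq(3) by blast
  qed
qed

theorem theorem4p9:
  fixes P :: "nat \<Rightarrow> 'a::idom poly" and d :: "nat \<Rightarrow> nat" and n s :: nat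
  assumes "integrally_hilbertian TYPE('a)"
    and "near_ufd TYPE('a) \<or> dedekind_domain TYPE('a)"
    and "s \<ge> 1"
    and "\<And>i. i < s \<Longrightarrow> Factorial_Ring.irreducible (fract_poly (P i))"
    and "\<not> (\<exists>I \<in> Nonunit. fixed_divisor_poly I (\<Prod>i<s. P i))"
    and "\<exists>j<n. d j \<noteq> 0"
  shows "\<exists>M \<in> carrier (mpoly_ring n (UNIV :: 'a set)).
    (\<forall>j<n. var_degree j M = d j) \<and>
    (\<forall>i<s. ring_irreducible\<^bsub>mpoly_ring n UNIV\<^esub> (subst_mpoly (P i) M)) \<and>
    \<not> (\<exists>I \<in> Nonunit. fixed_divisor_mpoly I (\<Prod>i<s. subst_mpoly (P i) M))"
proof -
  obtain j0 where j0: "j0 < n" "d j0 > 0" using assms(6) by auto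
  define D where "D = (\<Sum>j<n. Poly_Mapping.single j (d j))"
  have lookup_D: "Poly_Mapping.lookup D j = (if j < n then d j else 0)" for j
    by (simp add: D_def lookup_sum lookup_single when_def sum.delta')
  then have keys_D: "Poly_Mapping.keys D \<subseteq> {..<n}" by (auto simp: in_keys_iff split: if_splits)
  have "j0 \<in> Poly_Mapping.keys D" using j0 by (simp add: in_keys_iff lookup_D)
  then have D0: "D \<noteq> 0" by auto
  define Pp where "Pp = (\<Prod>i<s. P i)"
  have no_divisor: "\<not> (\<exists>I\<in>Nonunit. range (poly Pp) \<subseteq> I)"
  proof
    assume "\<exists>I\<in>Nonunit. range (poly Pp) \<subseteq> I"
    then obtain I where I: "I \<in> Nonunit" "range (poly Pp) \<subseteq> I" by blast
    then have "ideal I type_ring" "I \<noteq> UNIV" by (auto simp: Nonunit_def principalideal_def)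
    then have "fixed_divisor_poly I Pp" using I(2) by (auto simp: fixed_divisor_poly_def)
    then show False using assms(5) I(1) by (auto simp: Pp_def)
  qed
  \<comment> \<open>Bounds the degree of the univariate polynomial obtained by setting all variables
    except \<open>j0\<close> to 1; the adjustment must therefore provide N + 1 residues.\<close>
  define N where "N = Polynomial.degree Pp * d j0"
  have "Polynomial.degree Pp \<le> N" using j0(2) by (simp add: N_def)
  obtain Fam t w where detects: "detects_nonunits Fam" and w: "w \<noteq> 0"
    and adjusted: "\<And>p q. (p, q) \<in> Fam \<Longrightarrow> adjusted_at (Suc N) Pp t w p q"
    using exists_adjustment[OF assms(2) no_divisor, of N] by blast
  define R where "R i = pcompose (P i) [:t, w:]" for i
  define RR where "RR = pcompose Pp [:t, w:]"
  have RR: "RR = (\<Prod>i<s. R i)"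
    by (simp add: RR_def Pp_def R_def pcompose_prod)
  have irr: "Factorial_Ring.irreducible (fract_poly (R i))" if "i < s" for i
  proof -
    have "fract_poly (R i) = pcompose (fract_poly (P i)) [:to_fract t, to_fract w:]"
      by (simp add: R_def map_poly_pcompose[OF type_hom_to_fract] map_poly_pCons)
    then show ?thesis using irreducible_pcompose_linear[OF assms(4)[OF that]] w by simp
  qed
  have degR: "Polynomial.degree (R i) > 0" if "i < s" for i
    using irreducible_degree_pos[OF irr[OF that]] by (simp add: degree_map_poly)
  define PT where "PT i = shift_subst var0 D (map_poly mpoly_const (R i))" for i
  have prod_PT: "(\<Prod>i<s. PT i) = shift_subst var0 D (map_poly mpoly_const RR)"
    by (simp add: PT_def RR type_hom_prod[OF type_hom_map_poly[OF type_hom_mpoly_const]]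
        type_hom_prod[OF type_hom_shift_subst])
  have PT_carrier: "PT i \<in> carrier (mpoly_ring n (carrier (mpoly_ring 1 UNIV)))" for i
    unfolding PT_def
  proof (rule shift_subst_carrier[OF type_subring_mpoly_ring[OF type_subring_UNIV] _ _ keys_D])
    show "(var0 :: 'a mpoly) \<in> carrier (mpoly_ring 1 UNIV)" by (rule single_carrier) auto
    show "Polynomial.coeff (map_poly mpoly_const (R i)) k \<in> carrier (mpoly_ring 1 UNIV)" for k
      by (simp add: coeff_map_poly mpoly_const_carrier)
  qed
  have no_fixed: "\<not> (\<exists>I\<in>Nonunit. fixed_divisor I (\<Prod>i<s. PT i))"
  proof
    assume "\<exists>I\<in>Nonunit. fixed_divisor I (\<Prod>i<s. PT i)"
    then obtain I where I: "I \<in> Nonunit"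
      "\<And>m. vanishes_mod I (specialize m (\<Prod>i<s. PT i))" by (auto simp: fixed_divisor_def)
    \<comment> \<open>The constant term in Y of the product specialized at T = z is
      \<open>RR\<close> at z.\<close>
    have "poly RR z \<in> I" for z
      using I(2)[of "\<lambda>_. z"] lookup_shift_subst_0[OF D0, of z RR]
      unfolding vanishes_mod_def prod_PT specialize_shift_subst by metis
    then show False
      using adjusted_values_not_in_nonunit[OF detects adjusted no_divisor \<open>Polynomial.degree Pp \<le> N\<close> I(1)]
      by (simp add: RR_def)
  qed
  let ?H = "{m. (\<forall>i<s. ring_irreducible\<^bsub>mpoly_ring n UNIV\<^esub> (fract_mpoly (specialize m (PT i)))) \<and>
    \<not> (\<exists>I \<in> Nonunit. vanishes_mod I (\<Prod>i<s. specialize m (PT i)))}"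
  have "zariski_dense 1 ?H"
  proof (rule assms(1)[unfolded integrally_hilbertian_def, rule_format], intro conjI allI impI no_fixed PT_carrier)
    fix i assume i: "i < s"
    show "ring_irreducible\<^bsub>mpoly_ring n (rat_funs 1)\<^esub> (to_rat_QT_Y (PT i))"
      unfolding PT_def to_rat_QT_Y_shift_subst by (rule shift_subst_irreducible[OF irr[OF i] D0])
    show "primitive_wrt_QT 1 (PT i)"
      unfolding PT_def by (rule primitive_wrt_QT_shift_subst[OF D0]) (use degR[OF i] in auto)
  qed (use j0(1) assms(3) in auto)
  then obtain m where m: "m \<in> ?H" using zariski_dense_nonempty by blast
  define M where "M = mpoly_const t + mpoly_const w * (mpoly_const (m 0) + Poly_Mapping.single D 1)"
  have G: "specialize m (PT i) = subst_mpoly (P i) M" for i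
    unfolding PT_def specialize_shift_subst R_def M_def by (rule shift_subst_affine)
  have G': "subst_mpoly (P i) M = shift_subst (m 0) D (R i)" for i
    unfolding M_def R_def by (rule shift_subst_affine[symmetric])
  have prod_G: "(\<Prod>i<s. subst_mpoly (P i) M) = shift_subst (m 0) D RR"
    unfolding G' RR by (simp add: type_hom_prod[OF type_hom_shift_subst])
  have no_content: "\<not> (\<exists>I\<in>Nonunit. vanishes_mod I (\<Prod>i<s. subst_mpoly (P i) M))"
    and irr_fract: "\<And>i. i < s \<Longrightarrow> ring_irreducible\<^bsub>mpoly_ring n UNIV\<^esub> (fract_mpoly (subst_mpoly (P i) M))"
    using m by (simp_all add: G)
  show ?thesis
  proof (intro bexI conjI allI impI)
    have M_lookup: "Poly_Mapping.lookup M k = (if k = D then w else if k = 0 then t + w * m 0 else 0)" for k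
      using D0 by (auto simp: M_def lookup_add lookup_const_mult lookup_mpoly_const lookup_single when_def)
    show "M \<in> carrier (mpoly_ring n UNIV)"
      by (auto simp: carrier_mpoly_ring_iff in_keys_iff M_lookup lookup_D split: if_splits)
    fix j assume "j < n"
    \<comment> \<open>The condition that \<open>w\<close> is nonzero keeps the monomial with
      exponent \<open>D\<close>, which carries all prescribed degrees.\<close>
    have "D \<in> Poly_Mapping.keys M" using w by (simp add: in_keys_iff M_lookup)
    moreover have "Poly_Mapping.keys M \<subseteq> {0, D}"
      by (auto simp: in_keys_iff M_lookup split: if_splits)
    ultimately show "var_degree j M = d j"
      unfolding var_degree_def using \<open>j < n\<close>
      by (intro Max_eqI) (auto simp: lookup_D intro: image_eqI[of _ _ D])
  next
    fix i assume i: "i < s"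
    have "(\<Prod>i<s. subst_mpoly (P i) M) = subst_mpoly (P i) M * (\<Prod>i\<in>{..<s} - {i}. subst_mpoly (P i) M)"
      using i by (intro prod.remove) auto
    then have rest: "\<not> (\<exists>I\<in>Nonunit. vanishes_mod I (subst_mpoly (P i) M * (\<Prod>i\<in>{..<s} - {i}. subst_mpoly (P i) M)))"
      using no_content by simp
    show "ring_irreducible\<^bsub>mpoly_ring n UNIV\<^esub> (subst_mpoly (P i) M)"
      by (rule mpoly_ring_irreducible_of_fract[OF irr_fract[OF i] _ rest])
        (use shift_subst_nonconst[OF D0 degR[OF i]] in \<open>simp add: G'\<close>)
  next
    define g where "g = pcompose RR [:m 0, 1:]"
    have coeffs: "\<not> (\<exists>I\<in>Nonunit. range (Polynomial.coeff g) \<subseteq> I)"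
    proof
      assume "\<exists>I\<in>Nonunit. range (Polynomial.coeff g) \<subseteq> I"
      then obtain I where I: "I \<in> Nonunit" "range (Polynomial.coeff g) \<subseteq> I" by blast
      have "0 \<in> I" using I(1) by (auto simp: Nonunit_iff)
      have "Poly_Mapping.lookup (shift_subst (m 0) D RR) k \<in> I" for k
      proof (cases "\<exists>j. k = exponent_scale j D")
        case True
        then show ?thesis using I(2) lookup_shift_subst[OF D0, of "m 0" RR] by (auto simp: g_def)
      next
        case False
        then show ?thesis using lookup_shift_subst_other[of k D "m 0" RR] \<open>0 \<in> I\<close> by auto
      qed
      then show False using no_content I(1) by (auto simp: prod_G vanishes_mod_def)
    qed
    show "\<not> (\<exists>I\<in>Nonunit. fixed_divisor_mpoly I (\<Prod>i<s. subst_mpoly (P i) M))"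
    proof
      assume "\<exists>I\<in>Nonunit. fixed_divisor_mpoly I (\<Prod>i<s. subst_mpoly (P i) M)"
      then obtain I where I: "I \<in> Nonunit" "\<And>y. mpoly_eval y (shift_subst (m 0) D RR) \<in> I"
        by (auto simp: fixed_divisor_mpoly_def prod_G)
      have "poly g (y ^ d j0) \<in> I" for y
      proof -
        \<comment> \<open>At the point with coordinate y at \<open>j0\<close> and 1 elsewhere the
          monomial takes the value y^(d j0).\<close>
        have "(\<Prod>i\<in>Poly_Mapping.keys D. (if i = j0 then y else 1) ^ Poly_Mapping.lookup D i)
            = (\<Prod>i\<in>Poly_Mapping.keys D. if i = j0 then y ^ d j0 else 1)"
          using j0(1) by (intro prod.cong) (auto simp: lookup_D)
        also have "\<dots> = y ^ d j0" using \<open>j0 \<in> Poly_Mapping.keys D\<close> by (simp add: prod.delta)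
        finally show ?thesis
          using I(2)[of "\<lambda>i. if i = j0 then y else 1"] by (simp add: mpoly_eval_shift_subst g_def)
      qed
      then show False
        using adjusted_power_values_not_in_nonunit[OF detects adjusted g_def[unfolded RR_def] coeffs _ j0(2) I(1)]
        by (auto simp: N_def)
    qed
  qed
qed

end
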